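(* Let $\alpha>0$ and let $f_\alpha\colon S^1\to S^1$, $S^1=[0,1)$, be the intermittent map $$f_\alpha(x)=\begin{cases}x(1+2^\alpha x^\alpha)&x<1/2,\\2x-1&x\ge1/2.\end{cases}$$ Let $\tilde x\in(\tfrac12,1]$. Then the hitting time in balls around $\tilde x$ satisfies $$\lim_{r\to0}\frac{\log\tau_r(x,\tilde x)}{-\log r}=\max(1,\alpha)$$ for Lebesgue-a.e. $x\in S^1$.
   Context: $\tau_r(x,\tilde x)=\min\{n\in\mathbb{N}:n>0,\ f_\alpha^n(x)\in B(\tilde x,r)\}$, where $B(\tilde x,r)$ is the ball of centre $\tilde x$ and radius $r$ for the usual distance $|x-y|$. *)

theory Defs
  imports "HOL-Analysis.Analysis"
begin

text \<open>The circle is identified with the fundamental domain \<open>[0,1)\<close>.\<close>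

abbreviation circle :: "real set" where
  "circle \<equiv> {0..<1}"

text \<open>The map is only meaningful on \<^const>\<open>circle\<close>, which it leaves invariant.\<close>

definition intermittent_map :: "real \<Rightarrow> real \<Rightarrow> real" where
  "intermittent_map \<alpha> x =
     (if x < 1/2 then x * (1 + 2 powr \<alpha> * x powr \<alpha>) else 2 * x - 1)"

lemma intermittent_map_circle:
  assumes "\<alpha> > 0" "x \<in> circle"
  shows "intermittent_map \<alpha> x \<in> circle"
proof (cases "x < 1/2")
  case True
  have "2 powr \<alpha> * x powr \<alpha> = (2 * x) powr \<alpha>"
    using assms by (simp add: powr_mult)
  also have "\<dots> \<le> 1"
    using assms True by (intro powr_le1) auto
  finally have "x * (1 + 2 powr \<alpha> * x powr \<alpha>) \<le> x * 2"
    using assms by (intro mult_left_mono) auto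
  with True assms show ?thesis
    by (auto simp: intermittent_map_def)
qed (use assms in \<open>auto simp: intermittent_map_def\<close>)

text \<open>The infimum in \<^typ>\<open>enat\<close> is the minimum whenever the orbit reaches the ball,
  and \<open>\<infinity>\<close> when it never does.\<close>

definition hitting_time :: "('a::metric_space \<Rightarrow> 'a) \<Rightarrow> 'a \<Rightarrow> 'a \<Rightarrow> real \<Rightarrow> enat" where
  "hitting_time f x y r = Inf (enat ` {n. n > 0 \<and> (f ^^ n) x \<in> ball y r})"

definition log_enat :: "enat \<Rightarrow> ereal" where
  "log_enat n = (case n of enat k \<Rightarrow> ereal (ln (real k)) | \<infinity> \<Rightarrow> \<infinity>)"

end

theory Submission imports Defs "HOL-Real_Asymp.Real_Asymp"
begin

text \<open>
Write \<open>\<beta> = max 1 \<alpha>\<close>. Both branches of the map are convex and increasing and take the value \<open>0\<close> at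
their left end. Hence the image of a measure with decreasing density again has a decreasing density. In
terms of distribution functions: these stay concave, because one step of the dynamics composes them
with the concave inverse branches. All measure estimates below are comparisons of slopes of concave
functions; no transfer operator and no derivative of the map appears.

Let \<open>cut n\<close> be the \<open>n\<close>-th preimage of \<open>1\<close> under the left branch. It is of order \<open>n\<^sup>-\<^sup>1\<^sup>/\<^sup>\<alpha>\<close> and governs the time
spent near the neutral fixed point \<open>0\<close>.

\<^emph>\<open>Hitting is not faster.\<close> An orbit which is in \<open>(1/2,1]\<close> at a given time has, its density being decreasing,
conditional probability at least \<open>cut n\<close> of staying outside \<open>(1/2,1]\<close> for the next \<open>n\<close> steps. Decomposing
according to the last visit to \<open>(1/2,1]\<close>, the expected number of visits up to time \<open>n\<close> is at most \<open>1 / cut n\<close>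
(\<open>sum_visits_le\<close>). It is also at most \<open>n + 1\<close>, hence \<open>O(n\<^sup>1\<^sup>/\<^sup>\<beta>)\<close>. As \<open>y\<close> has positive distance from \<open>1/2\<close>, each
visit lands in the ball \<open>B(y,r)\<close> with probability \<open>O(r)\<close>. So the ball is hit before time \<open>n\<close> with
probability \<open>O(r n\<^sup>1\<^sup>/\<^sup>\<beta>)\<close> (\<open>hit_prob\<close>), and the Borel--Cantelli lemma along \<open>r = 2\<^sup>-\<^sup>j\<close> applies.

\<^emph>\<open>Hitting is not slower.\<close> The jump map sends a point to the image of its first orbit point in \<open>(1/2,1]\<close>. It
has countably many full branches, and decreasing densities are preserved even conditionally on
the branches used in the past. Two estimates follow. Given the past, the next image has a density bounded
below (\<open>mixing_lower_bound\<close>); a target of size \<open>r\<close> is therefore missed \<open>N\<close> times with probability at most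
\<open>exp (- \<kappa> r N)\<close> (\<open>miss_prob\<close>), and about \<open>1/r\<close> jumps suffice to hit it. Secondly, the densities of
all iterates are bounded above (\<open>density_bound\<close>), so that the duration of a jump has bounded moments of every
order \<open>p < 1/\<alpha>\<close>; if also \<open>p \<le> 1\<close>, then \<open>K\<close> jumps take at most about \<open>K\<^sup>1\<^sup>/\<^sup>p\<close> steps
(\<open>AE_jump_time_growth\<close>). Letting \<open>p\<close> tend to \<open>1/\<beta>\<close> yields the upper bound \<open>r\<^sup>-\<^sup>\<beta>\<close> up to arbitrarily
small changes of the exponent.
\<close>

section \<open>Concave functions and powers\<close>

text \<open>The slope of a concave function over a later interval is at most the slope over an
  earlier one. The product form stays meaningful for degenerate intervals. All estimates use
  concavity in this form.\<close>
lemma concave_slopes_decreasing: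
  fixes G :: "real \<Rightarrow> real"
  assumes G: "concave_on S G" and "a \<in> S" "d \<in> S" and ord: "a \<le> b" "b \<le> c" "c \<le> d"
  shows "(G d - G c) * (b - a) \<le> (G b - G a) * (d - c)"
proof (cases "a < b \<and> c < d")
  case False
  then show ?thesis using ord by auto
next
  case True
  have cvx: "convex_on S (\<lambda>x. - G x)"
    using G by (simp add: concave_on_def)
  have inS: "z \<in> S" if "a \<le> z" "z \<le> d" for z
    using concave_on_imp_convex[OF G] assms(2,3) that mem_is_interval_1_I[of S a d z]
    by (simp add: is_interval_convex_1)
  have sl: "(G z - G y) * (y - x) \<le> (G y - G x) * (z - y)"
    if "x < y" "y < z" "x \<in> S" "z \<in> S" for x y z
  proof -
    have "(- G x - - G y) / (x - y) \<le> (- G y - - G z) / (y - z)"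
      using convex_on_slope_le[OF cvx, of x z y] that by auto
    moreover have "x - y < 0" "y - z < 0" using that by auto
    ultimately show ?thesis
      by (simp add: divide_simps split: if_splits) (simp add: algebra_simps)
  qed
  show ?thesis
  proof (cases "b = c")
    case True
    then show ?thesis using sl[of a b d] \<open>a < b \<and> c < d\<close> assms(2,3) by auto
  next
    case False
    then have bc: "b < c" using ord by auto
    have 1: "(G c - G b) * (b - a) \<le> (G b - G a) * (c - b)"
      using sl[of a b c] True bc assms(2) inS ord by auto
    have 2: "(G d - G c) * (c - b) \<le> (G c - G b) * (d - c)"
      using sl[of b c d] True bc assms(3) inS ord by auto
    have "(G d - G c) * (b - a) * (c - b) \<le> (G c - G b) * (d - c) * (b - a)"
      using mult_right_mono[OF 2, of "b - a"] ord by (simp add: algebra_simps)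
    also have "\<dots> \<le> (G b - G a) * (d - c) * (c - b)"
      using mult_right_mono[OF 1, of "d - c"] ord by (simp add: algebra_simps)
    finally show ?thesis using bc by simp
  qed
qed

lemma concave_on_compose:
  fixes G h :: "real \<Rightarrow> real"
  assumes "concave_on S h" "concave_on T G" "mono_on T G" "h ` S \<subseteq> T"
  shows "concave_on S (\<lambda>x. G (h x))"
  unfolding concave_on_iff
proof (intro conjI ballI allI impI)
  show "convex S" using assms(1) by (rule concave_on_imp_convex)
  fix x y u v :: real
  assume xy: "x \<in> S" "y \<in> S" "0 \<le> u" "0 \<le> v" "u + v = 1"
  have T: "convex T" using assms(2) by (rule concave_on_imp_convex)
  have in1: "u *\<^sub>R h x + v *\<^sub>R h y \<in> T"
    using T xy assms(4) by (intro convexD) auto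
  have in2: "u *\<^sub>R x + v *\<^sub>R y \<in> S"
    using \<open>convex S\<close> xy by (intro convexD) auto
  have h: "u * h x + v * h y \<le> h (u *\<^sub>R x + v *\<^sub>R y)"
    using assms(1) xy unfolding concave_on_iff by auto
  have "u * G (h x) + v * G (h y) \<le> G (u *\<^sub>R h x + v *\<^sub>R h y)"
    using assms(2,4) xy unfolding concave_on_iff by (auto simp: image_subset_iff)
  also have "\<dots> \<le> G (h (u *\<^sub>R x + v *\<^sub>R y))"
    using assms(3,4) in1 in2 h by (auto simp: mono_on_def)
  finally show "u * G (h x) + v * G (h y) \<le> G (h (u *\<^sub>R x + v *\<^sub>R y))" .
qed

lemma concave_on_cong: "(\<And>x. x \<in> S \<Longrightarrow> f x = h x) \<Longrightarrow> concave_on S f \<longleftrightarrow> concave_on S (h::real\<Rightarrow>real)"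
  unfolding concave_on_iff by (intro conj_cong refl ball_cong all_cong imp_cong)
    (metis convexD)+

text \<open>Needed because a branch of the jump map contributes one summand to its distribution function,
  and there are infinitely many branches.\<close>
lemma concave_on_sums:
  fixes F :: "real \<Rightarrow> real"
  assumes "\<And>n. concave_on S (f n)" "\<And>t. t \<in> S \<Longrightarrow> (\<lambda>n. f n t) sums F t"
  shows "concave_on S F"
  unfolding concave_on_iff
proof (intro conjI ballI allI impI)
  show "convex S" using assms(1)[of 0] by (rule concave_on_imp_convex)
  fix x y u v :: real
  assume xy: "x \<in> S" "y \<in> S" and uv: "0 \<le> u" "0 \<le> v" "u + v = 1"
  have z: "u *\<^sub>R x + v *\<^sub>R y \<in> S"
    using \<open>convex S\<close> xy uv by (intro convexD) auto
  have "(\<lambda>n. u * f n x + v * f n y) sums (u * F x + v * F y)"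
    using assms(2) xy by (intro sums_add sums_mult) auto
  moreover have "u * f n x + v * f n y \<le> f n (u *\<^sub>R x + v *\<^sub>R y)" for n
    using assms(1)[of n] xy uv unfolding concave_on_iff by blast
  ultimately show "u * F x + v * F y \<le> F (u *\<^sub>R x + v *\<^sub>R y)"
    using assms(2)[OF z] by (meson sums_le)
qed

lemma powr_add_le_add_powr:
  fixes a b p :: real
  assumes "0 \<le> a" "0 \<le> b" "0 < p" "p \<le> 1"
  shows "(a + b) powr p \<le> a powr p + b powr p"
proof (cases "a + b = 0")
  case True then show ?thesis using assms by simp
next
  case False
  then have s: "a + b > 0" using assms by auto
  have le: "z / (a + b) \<le> (z / (a + b)) powr p" if "0 \<le> z" "z \<le> a + b" for z
    using that s assms powr_mono'[of p 1 "z / (a+b)"] by (simp add: divide_simps)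
  have "1 = a / (a + b) + b / (a + b)"
    using s by (simp flip: add_divide_distrib)
  also have "\<dots> \<le> (a / (a + b)) powr p + (b / (a + b)) powr p"
    using le[of a] le[of b] assms by auto
  also have "\<dots> = (a powr p + b powr p) / (a + b) powr p"
    using assms by (simp add: powr_divide add_divide_distrib)
  finally show ?thesis using s by (simp add: field_simps)
qed

lemma powr_sum_le_sum_powr:
  fixes f :: "'a \<Rightarrow> real"
  assumes "\<And>i. i \<in> A \<Longrightarrow> 0 \<le> f i" "0 < p" "p \<le> 1"
  shows "(\<Sum>i\<in>A. f i) powr p \<le> (\<Sum>i\<in>A. f i powr p)"
  using assms(1)
proof (induction A rule: infinite_finite_induct)
  case (insert x F)
  have "(f x + sum f F) powr p \<le> f x powr p + sum f F powr p"
    using insert.prems assms(2,3) by (intro powr_add_le_add_powr sum_nonneg) auto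
  also have "\<dots> \<le> f x powr p + (\<Sum>i\<in>F. f i powr p)"
    using insert.IH insert.prems by simp
  finally show ?case using insert.hyps by simp
qed (use assms in auto)

section \<open>The branches of the map\<close>

locale intermittent =
  fixes \<alpha> :: real
  assumes alpha_pos: "\<alpha> > 0"
begin

text \<open>The left branch, extended to all of \<open>[0,\<infinity>)\<close>. The extension past \<open>1/2\<close> stays convex, and the room it
  gives to the right of \<open>1\<close> is what makes the distortion estimate \<open>jump_inv_spread\<close> possible.\<close>
definition L :: "real \<Rightarrow> real" where "L x = x * (1 + 2 powr \<alpha> * x powr \<alpha>)"

lemma L_0 [simp]: "L 0 = 0" by (simp add: L_def)

lemma L_half [simp]: "L (1/2) = 1"
  by (simp add: L_def flip: powr_mult)

lemma L_alt: "0 \<le> x \<Longrightarrow> L x = x + 2 powr \<alpha> * x powr (1 + \<alpha>)"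
  using alpha_pos by (cases "x = 0") (auto simp: L_def algebra_simps powr_add)

lemma L_alt': "0 \<le> x \<Longrightarrow> L x = x * (1 + (2 * x) powr \<alpha>)"
  by (simp add: L_def powr_mult)

text \<open>The branch is the identity plus an increasing function.\<close>
lemma L_expanding:
  assumes "0 \<le> u" "u \<le> v"
  shows "v - u \<le> L v - L u"
proof -
  have "u powr (1 + \<alpha>) \<le> v powr (1 + \<alpha>)"
    using assms alpha_pos by (intro powr_mono2) auto
  then show ?thesis using assms by (simp add: L_alt)
qed

lemma L_mono: "0 \<le> u \<Longrightarrow> u \<le> v \<Longrightarrow> L u \<le> L v"
  using L_expanding[of u v] by linarith

lemma L_strict_mono: "0 \<le> u \<Longrightarrow> u < v \<Longrightarrow> L u < L v"
  using L_expanding[of u v] by linarith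

lemma L_ge: "0 \<le> u \<Longrightarrow> u \<le> L u"
  using L_expanding[of 0 u] by simp

lemma L_le_iff: "0 \<le> u \<Longrightarrow> 0 \<le> v \<Longrightarrow> L u \<le> L v \<longleftrightarrow> u \<le> v"
  using L_mono L_strict_mono by (meson not_le)

lemma L_convex: "convex_on {0..} L"
  unfolding convex_on_def
proof (intro conjI ballI allI impI)
  show "convex {0::real..}" by simp
  have 0: "L (v * y) \<le> v * L y" if "0 \<le> y" "0 \<le> v" "v \<le> 1" for v y
  proof -
    have "(v * y) powr \<alpha> \<le> y powr \<alpha>"
      using that alpha_pos by (intro powr_mono2) (auto simp: mult_left_le_one_le)
    then have "v * y * (1 + 2 powr \<alpha> * (v * y) powr \<alpha>) \<le> v * y * (1 + 2 powr \<alpha> * y powr \<alpha>)"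
      using that by (intro mult_left_mono) auto
    then show ?thesis by (simp add: L_def algebra_simps)
  qed
  fix x y u v :: real
  assume xy: "x \<in> {0..}" "y \<in> {0..}" and uv: "0 \<le> u" "0 \<le> v" "u + v = 1"
  consider "x = 0" | "y = 0" | "0 < x" "0 < y" using xy by fastforce
  then show "L (u *\<^sub>R x + v *\<^sub>R y) \<le> u * L x + v * L y"
  proof cases
    case 1 then show ?thesis using 0[of y v] xy uv by auto
  next
    case 2 then show ?thesis using 0[of x u] xy uv by auto
  next
    case 3
    have "(u *\<^sub>R x + v *\<^sub>R y) powr (1 + \<alpha>) \<le> u * x powr (1 + \<alpha>) + v * y powr (1 + \<alpha>)"
      using powr_convex[of "1 + \<alpha>"] alpha_pos 3 uv unfolding convex_on_def by auto
    then have "2 powr \<alpha> * (u *\<^sub>R x + v *\<^sub>R y) powr (1 + \<alpha>)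
        \<le> 2 powr \<alpha> * (u * x powr (1 + \<alpha>) + v * y powr (1 + \<alpha>))"
      by (intro mult_left_mono) auto
    then show ?thesis using xy uv by (simp add: L_alt algebra_simps)
  qed
qed

lemma L_continuous: "continuous_on {0..} L"
  unfolding L_def using alpha_pos
  by (intro continuous_intros continuous_on_powr') auto

lemma L_measurable [measurable]: "L \<in> borel_measurable borel"
  unfolding L_def by measurable

definition L_inv :: "real \<Rightarrow> real" where "L_inv = the_inv_into {0..} L"

lemma L_bij: "bij_betw L {0..} {0..}"
proof -
  have "inj_on L {0..}"
    by (rule strict_mono_on_imp_inj_on) (auto simp: strict_mono_on_def L_strict_mono)
  moreover have "t \<in> L ` {0..}" if "0 \<le> t" for t
  proof -
    have "\<exists>x\<ge>0. x \<le> t \<and> L x = t"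
      using that L_ge[of t] by (intro IVT' continuous_on_subset[OF L_continuous]) auto
    then show ?thesis by auto
  qed
  moreover have "L x \<ge> 0" if "x \<ge> 0" for x using L_ge that by fastforce
  ultimately show ?thesis unfolding bij_betw_def by auto
qed

lemma L_nonneg: "x \<ge> 0 \<Longrightarrow> L x \<ge> 0"
  using L_ge by fastforce

lemma L_inv_nonneg: "0 \<le> t \<Longrightarrow> 0 \<le> L_inv t"
  using bij_betw_the_inv_into[OF L_bij] by (auto simp: L_inv_def bij_betw_def)

lemma L_L_inv: "0 \<le> t \<Longrightarrow> L (L_inv t) = t"
  unfolding L_inv_def using f_the_inv_into_f_bij_betw[OF L_bij] by auto

lemma L_inv_L: "0 \<le> t \<Longrightarrow> L_inv (L t) = t"
  unfolding L_inv_def using the_inv_into_f_f[of L "{0..}"] L_bij by (auto simp: bij_betw_def)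

lemma le_L_inv_iff: "0 \<le> x \<Longrightarrow> 0 \<le> t \<Longrightarrow> x \<le> L_inv t \<longleftrightarrow> L x \<le> t"
  using L_le_iff[of x "L_inv t"] L_L_inv L_inv_nonneg by auto

lemma L_inv_less_iff: "0 \<le> x \<Longrightarrow> 0 \<le> t \<Longrightarrow> L_inv t < x \<longleftrightarrow> t < L x"
  by (simp add: le_L_inv_iff flip: not_le)

lemma L_inv_mono: "0 \<le> s \<Longrightarrow> s \<le> t \<Longrightarrow> L_inv s \<le> L_inv t"
  using le_L_inv_iff[of "L_inv s" t] L_L_inv L_inv_nonneg by auto

lemma L_inv_strict_mono: "0 \<le> s \<Longrightarrow> s < t \<Longrightarrow> L_inv s < L_inv t"
  using L_inv_less_iff[of "L_inv t" s] L_L_inv L_inv_nonneg by auto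

lemma L_inv_le: "0 \<le> t \<Longrightarrow> L_inv t \<le> t"
  using L_ge[of "L_inv t"] L_L_inv L_inv_nonneg by auto

lemma L_inv_0 [simp]: "L_inv 0 = 0" using L_inv_L[of 0] by simp

lemma L_inv_1 [simp]: "L_inv 1 = 1/2" using L_inv_L[of "1/2"] by simp

text \<open>The inverse of an increasing convex function is concave.\<close>
lemma L_inv_concave: "concave_on {0..} L_inv"
  unfolding concave_on_iff
proof (intro conjI ballI allI impI)
  fix x y u v :: real
  assume xy: "x \<in> {0..}" "y \<in> {0..}" and uv: "0 \<le> u" "0 \<le> v" "u + v = 1"
  have "L (u *\<^sub>R L_inv x + v *\<^sub>R L_inv y) \<le> u * L (L_inv x) + v * L (L_inv y)"
    using L_convex xy uv L_inv_nonneg unfolding convex_on_def by auto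
  then show "u * L_inv x + v * L_inv y \<le> L_inv (u *\<^sub>R x + v *\<^sub>R y)"
    using xy uv L_inv_nonneg L_L_inv by (subst le_L_inv_iff) auto
qed simp

lemma L_pow_nonneg: "0 \<le> u \<Longrightarrow> 0 \<le> (L ^^ n) u"
  by (induction n) (auto intro: L_nonneg)

lemma L_pow_mono: "0 \<le> u \<Longrightarrow> u \<le> v \<Longrightarrow> (L ^^ n) u \<le> (L ^^ n) v"
  by (induction n) (auto intro: L_mono L_pow_nonneg)

lemma L_pow_expanding: "0 \<le> u \<Longrightarrow> u \<le> v \<Longrightarrow> v - u \<le> (L ^^ n) v - (L ^^ n) u"
proof (induction n)
  case (Suc n)
  then show ?case
    using L_expanding[of "(L ^^ n) u" "(L ^^ n) v"] L_pow_mono L_pow_nonneg by fastforce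
qed simp

lemma L_inv_pow_nonneg: "0 \<le> u \<Longrightarrow> 0 \<le> (L_inv ^^ n) u"
  by (induction n) (auto intro: L_inv_nonneg)

lemma L_inv_pow_mono: "0 \<le> u \<Longrightarrow> u \<le> v \<Longrightarrow> (L_inv ^^ n) u \<le> (L_inv ^^ n) v"
  by (induction n) (auto intro: L_inv_mono L_inv_pow_nonneg)

lemma le_L_inv_pow_iff: "0 \<le> x \<Longrightarrow> 0 \<le> t \<Longrightarrow> x \<le> (L_inv ^^ n) t \<longleftrightarrow> (L ^^ n) x \<le> t"
proof (induction n arbitrary: t)
  case (Suc n)
  have "x \<le> (L_inv ^^ Suc n) t \<longleftrightarrow> x \<le> (L_inv ^^ n) (L_inv t)" by (simp add: funpow_swap1)
  also have "\<dots> \<longleftrightarrow> (L ^^ n) x \<le> L_inv t" using Suc L_inv_nonneg by auto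
  also have "\<dots> \<longleftrightarrow> (L ^^ Suc n) x \<le> t" using Suc.prems by (simp add: le_L_inv_iff L_pow_nonneg)
  finally show ?case .
qed simp

lemma L_inv_pow_concave: "concave_on {0..} (L_inv ^^ n)"
proof (induction n)
  case 0
  then show ?case by (simp add: concave_on_iff)
next
  case (Suc n)
  have "concave_on {0..} (\<lambda>x. L_inv ((L_inv ^^ n) x))"
    by (rule concave_on_compose[OF Suc L_inv_concave]) (auto simp: mono_on_def L_inv_mono L_inv_pow_nonneg)
  then show ?case by (simp add: o_def)
qed

text \<open>The backward orbit of \<open>1\<close> under the left branch. The left branch maps the interval between
  consecutive points onto the one before it, so a point in \<open>(cut (Suc n), cut n]\<close> needs exactly
  \<open>n\<close> steps to reach \<open>(1/2,1]\<close>.\<close>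
definition cut :: "nat \<Rightarrow> real" where "cut n = (L_inv ^^ n) 1"

lemma cut_0 [simp]: "cut 0 = 1" by (simp add: cut_def)
lemma cut_1 [simp]: "cut (Suc 0) = 1/2" by (simp add: cut_def)
lemma cut_Suc: "cut (Suc n) = L_inv (cut n)" by (simp add: cut_def)

lemma cut_pos: "cut n > 0"
proof (induction n)
  case (Suc n)
  then show ?case using L_inv_strict_mono[of 0 "cut n"] by (simp add: cut_Suc)
qed simp

lemma L_cut [simp]: "L (cut (Suc n)) = cut n"
  using cut_pos[of n] by (simp add: cut_Suc L_L_inv)

lemma cut_Suc_less: "cut (Suc n) < cut n"
proof -
  have "cut (Suc n) < L (cut (Suc n))"
    using cut_pos[of "Suc n"] L_def by (simp add: algebra_simps)
  then show ?thesis by simp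
qed

lemma cut_antimono: "m \<le> n \<Longrightarrow> cut n \<le> cut m"
  by (rule lift_Suc_antimono_le[of cut]) (rule less_imp_le[OF cut_Suc_less])

lemma cut_le_1: "cut n \<le> 1"
  using cut_antimono[of 0 n] by simp

lemma L_inv_pow_cut: "(L_inv ^^ n) (cut m) = cut (n + m)"
  by (simp add: cut_def funpow_add)

lemma cut_recurrence: "cut n = cut (Suc n) * (1 + (2 * cut (Suc n)) powr \<alpha>)"
  by (metis L_cut L_alt' cut_pos less_imp_le)

section \<open>The left preimages of 1\<close>

text \<open>With \<open>u = (2 cut (n+1))\<^sup>\<alpha>\<close> the recurrence reads \<open>cut n = cut (n+1) (1 + u)\<close>, so the increment of
  \<open>cut\<^sup>-\<^sup>\<alpha>\<close> is \<open>cut n\<^sup>-\<^sup>\<alpha> ((1 + u)\<^sup>\<alpha> - 1)\<close>. The second factor is comparable to \<open>u\<close>, and \<open>cut n\<^sup>-\<^sup>\<alpha> u\<close> lies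
  between \<open>1\<close> and \<open>2\<^sup>\<alpha>\<close>. Hence \<open>cut\<^sup>-\<^sup>\<alpha>\<close> grows linearly, which is the law \<open>cut n \<asymp> n\<^sup>-\<^sup>1\<^sup>/\<^sup>\<alpha>\<close>.\<close>
lemma cut_neg_powr_increment:
  defines "a \<equiv> \<lambda>n. cut n powr (- \<alpha>)"
  shows "a n + \<alpha> / 2 \<le> a (Suc n)" and "a (Suc n) \<le> a n + \<alpha> * exp \<alpha> * 2 powr \<alpha>"
proof -
  define d where "d = cut (Suc n)"
  define u where "u = (2 * d) powr \<alpha>"
  have d: "0 < d" "d \<le> 1/2"
    using cut_pos[of "Suc n"] cut_antimono[of 1 "Suc n"] by (auto simp: d_def)
  have u: "0 < u" "u \<le> 1"
    using d alpha_pos by (auto simp: u_def intro!: powr_le1)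
  have cn: "cut n = d * (1 + u)"
    using cut_recurrence[of n] by (simp add: d_def u_def)
  have an: "a (Suc n) = a n * (1 + u) powr \<alpha>"
    using d u by (simp add: a_def cn powr_mult powr_minus_divide flip: d_def)
  have an0: "0 < a n" using cut_pos[of n] by (simp add: a_def)
  have au: "a n * u = 2 powr \<alpha> * (d / cut n) powr \<alpha>"
    using d cut_pos[of n] by (simp add: a_def u_def powr_mult powr_divide powr_minus_divide)
  have ub: "a n * u \<le> 2 powr \<alpha>"
    unfolding au using d u alpha_pos cut_pos[of n] cut_Suc_less[of n]
    by (intro mult_left_le powr_le1) (auto simp: d_def)
  have "2 powr \<alpha> * (d / cut n) powr \<alpha> = (2 * (d / cut n)) powr \<alpha>"
    using d cut_pos[of n] by (subst powr_mult) auto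
  also have "\<dots> \<ge> 1"
    using d u alpha_pos by (intro ge_one_powr_ge_zero) (auto simp: cn)
  finally have lb: "a n * u \<ge> 1" by (simp add: au)
  have pe: "(1 + u) powr \<alpha> = exp (\<alpha> * ln (1 + u))"
    using u by (simp add: powr_def)
  have "u / 2 \<le> u / (1 + u)" using u by (simp add: field_simps)
  also have "u / (1 + u) \<le> ln (1 + u)"
    using ln_le_minus_one[of "1 / (1 + u)"] u by (simp add: ln_div field_simps)
  finally have "1 + \<alpha> * (u / 2) \<le> exp (\<alpha> * ln (1 + u))"
    using alpha_pos by (intro order_trans[OF _ exp_ge_add_one_self]) auto
  then have "a n * (1 + \<alpha> * (u / 2)) \<le> a (Suc n)"
    unfolding an pe using an0 by (intro mult_left_mono) auto
  moreover have "\<alpha> / 2 * (a n * u) \<ge> \<alpha> / 2 * 1"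
    using lb alpha_pos by (intro mult_left_mono) auto
  ultimately show "a n + \<alpha> / 2 \<le> a (Suc n)" by (simp add: algebra_simps)
  have "exp (\<alpha> * ln (1 + u)) \<le> exp (\<alpha> * u)"
    using u alpha_pos ln_add_one_self_le_self[of u] by auto
  also have "\<dots> \<le> 1 + \<alpha> * u * exp (\<alpha> * u)"
    using exp_ge_add_one_self[of "- (\<alpha> * u)"] by (simp add: exp_minus field_simps)
  also have "\<dots> \<le> 1 + \<alpha> * u * exp \<alpha>"
    using u alpha_pos by (intro add_left_mono mult_left_mono) (auto simp: mult_left_le)
  finally have "a (Suc n) \<le> a n * (1 + \<alpha> * u * exp \<alpha>)"
    unfolding an pe using an0 by (intro mult_left_mono) auto
  moreover have "\<alpha> * exp \<alpha> * (a n * u) \<le> \<alpha> * exp \<alpha> * 2 powr \<alpha>"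
    using ub alpha_pos by (intro mult_left_mono) auto
  ultimately show "a (Suc n) \<le> a n + \<alpha> * exp \<alpha> * 2 powr \<alpha>" by (simp add: algebra_simps)
qed

lemma cut_neg_powr_ge: "1 + real n * (\<alpha> / 2) \<le> cut n powr (- \<alpha>)"
proof (induction n)
  case (Suc n)
  then show ?case using cut_neg_powr_increment(1)[of n] by (simp add: field_simps)
qed simp

lemma cut_neg_powr_le: "cut n powr (- \<alpha>) \<le> 1 + real n * (\<alpha> * exp \<alpha> * 2 powr \<alpha>)"
proof (induction n)
  case (Suc n)
  then show ?case using cut_neg_powr_increment(2)[of n] by (simp add: algebra_simps)
qed simp

lemma cut_eq: "cut n = (cut n powr (- \<alpha>)) powr (- 1 / \<alpha>)"
  using alpha_pos cut_pos[of n] by (simp add: powr_powr)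

lemma cut_upper_bound:
  obtains C where "C > 0" "\<And>n. cut n \<le> C * real (n + 1) powr (- 1 / \<alpha>)"
proof
  define q where "q = min 1 (\<alpha> / 2)"
  have q: "q > 0" using alpha_pos by (simp add: q_def)
  show "q powr (- 1 / \<alpha>) > 0" using q by simp
  fix n
  have "q * real (n + 1) \<le> 1 + real n * (\<alpha> / 2)"
    using mult_right_mono[of q "\<alpha>/2" "real n"] min.cobounded1[of 1 "\<alpha>/2"] min.cobounded2[of 1 "\<alpha>/2"]
    unfolding q_def[symmetric] by (simp add: algebra_simps)
  then have *: "q * real (n + 1) \<le> cut n powr (- \<alpha>)"
    using cut_neg_powr_ge[of n] by linarith
  have "(cut n powr (- \<alpha>)) powr (- 1 / \<alpha>) \<le> (q * real (n + 1)) powr (- 1 / \<alpha>)"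
    using q alpha_pos by (intro powr_mono2' *) auto
  then show "cut n \<le> q powr (- 1 / \<alpha>) * real (n + 1) powr (- 1 / \<alpha>)"
    using cut_eq[of n] q by (simp add: powr_mult)
qed

lemma cut_lower_bound:
  obtains C where "C > 0" "\<And>n. 1 / cut n \<le> C * real (n + 1) powr (1 / \<alpha>)"
proof
  define q where "q = max 1 (\<alpha> * exp \<alpha> * 2 powr \<alpha>)"
  have q: "q > 0" by (simp add: q_def)
  show "q powr (1 / \<alpha>) > 0" using q by simp
  fix n
  have "1 + real n * (\<alpha> * exp \<alpha> * 2 powr \<alpha>) \<le> q * real (n + 1)"
    using mult_right_mono[of "\<alpha> * exp \<alpha> * 2 powr \<alpha>" q "real n"]
      max.cobounded1[of 1 "\<alpha> * exp \<alpha> * 2 powr \<alpha>"] max.cobounded2[of "\<alpha> * exp \<alpha> * 2 powr \<alpha>" 1]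
    unfolding q_def[symmetric] by (simp add: algebra_simps)
  then have *: "cut n powr (- \<alpha>) \<le> q * real (n + 1)"
    using cut_neg_powr_le[of n] by linarith
  have "1 / cut n = (cut n powr (- \<alpha>)) powr (1 / \<alpha>)"
    using alpha_pos cut_pos[of n] by (simp only: powr_powr) (simp add: powr_minus_divide)
  also have "\<dots> \<le> (q * real (n + 1)) powr (1 / \<alpha>)"
    using alpha_pos by (intro powr_mono2 *) auto
  finally show "1 / cut n \<le> q powr (1 / \<alpha>) * real (n + 1) powr (1 / \<alpha>)"
    using q by (simp add: powr_mult)
qed

lemma cut_tendsto_0: "cut \<longlonglongrightarrow> 0"
proof -
  obtain C where C: "C > 0" "\<And>n. cut n \<le> C * real (n + 1) powr (- 1 / \<alpha>)"
    using cut_upper_bound by blast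
  have "(\<lambda>n. C * real (n + 1) powr (- 1 / \<alpha>)) \<longlonglongrightarrow> 0"
    using alpha_pos by real_asymp
  then show ?thesis
    by (rule tendsto_sandwich[OF _ _ tendsto_const, rotated 2])
       (use C cut_pos in \<open>auto intro!: always_eventually less_imp_le\<close>)
qed

text \<open>The gap \<open>cut n - cut (n+1) = 2\<^sup>\<alpha> cut (n+1)\<^sup>1\<^sup>+\<^sup>\<alpha>\<close> decays like \<open>n\<close> to the power \<open>-1 - 1/\<alpha>\<close>. Being the
  probability that a uniform point of \<open>(0,1]\<close> needs \<open>n\<close> steps to reach \<open>(1/2,1]\<close>, it makes \<open>1/\<alpha>\<close> the critical order for
  the moments of that time.\<close>
lemma summable_moment_cut:
  assumes "p < 1 / \<alpha>"
  shows "summable (\<lambda>n. real (n + 1) powr p * (cut n - cut (Suc n)))"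
proof -
  obtain C where C: "C > 0" "\<And>n. cut n \<le> C * real (n + 1) powr (- 1 / \<alpha>)"
    using cut_upper_bound by blast
  have diff: "cut n - cut (Suc n) \<le> 2 powr \<alpha> * C powr (1 + \<alpha>) * real (n + 1) powr (- 1 / \<alpha> - 1)" for n
  proof -
    have "cut n - cut (Suc n) = 2 powr \<alpha> * cut (Suc n) powr (1 + \<alpha>)"
      using cut_recurrence[of n] cut_pos[of "Suc n"] by (simp add: powr_mult powr_add algebra_simps)
    also have "cut (Suc n) powr (1 + \<alpha>) \<le> (C * real (n + 1) powr (- 1 / \<alpha>)) powr (1 + \<alpha>)"
      using C(2)[of n] cut_Suc_less[of n] cut_pos[of "Suc n"] alpha_pos by (intro powr_mono2) auto
    also have "\<dots> = C powr (1 + \<alpha>) * real (n + 1) powr (- 1 / \<alpha> - 1)"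
    proof -
      have "- 1 / \<alpha> * (1 + \<alpha>) = - 1 / \<alpha> - 1" using alpha_pos by (simp add: field_simps)
      then show ?thesis using C(1) by (simp only: powr_mult powr_powr)
    qed
    finally show ?thesis by (simp add: mult.assoc)
  qed
  have "summable (\<lambda>n. real n powr (p - 1 / \<alpha> - 1))"
    using assms by (subst summable_real_powr_iff) auto
  then have "summable (\<lambda>n. real (n + 1) powr (p - 1 / \<alpha> - 1))"
    using summable_iff_shift[of "\<lambda>n. real n powr (p - 1 / \<alpha> - 1)" 1] by simp
  then have s: "summable (\<lambda>n. 2 powr \<alpha> * C powr (1 + \<alpha>) * real (n + 1) powr (p - 1 / \<alpha> - 1))"
    by (rule summable_mult)
  show ?thesis
  proof (rule summable_comparison_test'[OF s])
    fix n :: nat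
    have "real (n + 1) powr p * (cut n - cut (Suc n))
        \<le> real (n + 1) powr p * (2 powr \<alpha> * C powr (1 + \<alpha>) * real (n + 1) powr (- 1 / \<alpha> - 1))"
      by (intro mult_left_mono diff) auto
    also have "\<dots> = 2 powr \<alpha> * C powr (1 + \<alpha>) * (real (n + 1) powr p * real (n + 1) powr (- 1 / \<alpha> - 1))"
      by (simp only: mult_ac)
    also have "real (n + 1) powr p * real (n + 1) powr (- 1 / \<alpha> - 1) = real (n + 1) powr (p - 1 / \<alpha> - 1)"
      by (simp flip: powr_add add: algebra_simps)
    finally show "norm (real (n + 1) powr p * (cut n - cut (Suc n)))
        \<le> 2 powr \<alpha> * C powr (1 + \<alpha>) * real (n + 1) powr (p - 1 / \<alpha> - 1)"
      using cut_Suc_less[of n] by simp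
  qed
qed

section \<open>The lower bound: visits to the right half\<close>

text \<open>The intermittent map with the branch point \<open>1/2\<close> assigned to the left branch. On \<open>(0,1]\<close> both branches
  are then full, without exceptional points; the orbits differ from those of \<^const>\<open>intermittent_map\<close> only
  on the countable set of preimages of \<open>1/2\<close> (see \<open>AE_imap_eq\<close>).\<close>
definition imap :: "real \<Rightarrow> real" where "imap x = (if x \<le> 1/2 then L x else 2 * x - 1)"

definition D :: "real measure" where "D = restrict_space lborel {0<..1}"

lemma space_D: "space D = {0<..1}" by (simp add: D_def)

lemma emeasure_D: "A \<subseteq> {0<..1} \<Longrightarrow> emeasure D A = emeasure lborel A"
  by (simp add: D_def emeasure_restrict_space)

lemma measure_D_Ioc: "0 \<le> a \<Longrightarrow> a \<le> b \<Longrightarrow> b \<le> 1 \<Longrightarrow> measure D {a<..b} = b - a"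
  by (subst measure_def, subst emeasure_D) auto

sublocale D: finite_measure D
proof
  have "emeasure D {0<..1} = 1" by (subst emeasure_D) auto
  then show "emeasure D (space D) \<noteq> \<infinity>" by (simp add: space_D)
qed

lemma measure_D_le_1: "measure D A \<le> 1"
  using D.bounded_measure[of A] measure_D_Ioc[of 0 1] by (simp add: space_D)

lemma borel_measurable_D: "f \<in> borel_measurable borel \<Longrightarrow> f \<in> borel_measurable D"
  by (simp add: D_def measurable_restrict_space1)

lemma imap_measurable [measurable]: "imap \<in> borel_measurable borel"
  unfolding imap_def by measurable

lemma imap_pow_measurable [measurable]: "(imap ^^ k) \<in> borel_measurable borel"
  by (induction k) simp_all

lemma imap_pow_measurable_D [measurable]: "(imap ^^ k) \<in> borel_measurable D"
  by (rule borel_measurable_D) simp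

lemma imap_in: "x \<in> {0<..1} \<Longrightarrow> imap x \<in> {0<..1}"
  using L_strict_mono[of 0 x] L_mono[of x "1/2"] by (auto simp: imap_def)

lemma imap_pow_in: "x \<in> {0<..1} \<Longrightarrow> (imap ^^ k) x \<in> {0<..1}"
  by (induction k) (auto simp del: greaterThanAtMost_iff intro: imap_in)

lemma imap_le_iff:
  assumes "x \<in> {0<..1}" "t \<in> {0..1}"
  shows "imap x \<le> t \<longleftrightarrow> x \<le> L_inv t \<or> (1/2 < x \<and> x \<le> (1 + t) / 2)"
  using assms le_L_inv_iff[of x t] L_inv_mono[of t 1] by (auto simp: imap_def)

definition cdf :: "nat \<Rightarrow> real \<Rightarrow> real" where
  "cdf k t = measure D {x\<in>space D. (imap ^^ k) x \<le> t}"

lemma cdf_mono: "s \<le> t \<Longrightarrow> cdf k s \<le> cdf k t"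
  unfolding cdf_def by (rule D.finite_measure_mono) auto

lemma cdf_le_1: "cdf k t \<le> 1"
  unfolding cdf_def by (rule measure_D_le_1)

lemma cdf_1: "cdf k 1 = 1"
proof -
  have "{x\<in>space D. (imap ^^ k) x \<le> 1} = {0<..1}" using imap_pow_in by (fastforce simp: space_D)
  then show ?thesis using measure_D_Ioc[of 0 1] by (simp add: cdf_def)
qed

lemma cdf_Ioc:
  assumes "a \<le> b"
  shows "measure D {x\<in>space D. a < (imap ^^ k) x \<and> (imap ^^ k) x \<le> b} = cdf k b - cdf k a"
proof -
  have "{x\<in>space D. a < (imap ^^ k) x \<and> (imap ^^ k) x \<le> b}
      = {x\<in>space D. (imap ^^ k) x \<le> b} - {x\<in>space D. (imap ^^ k) x \<le> a}" by auto
  moreover have "{x\<in>space D. (imap ^^ k) x \<le> a} \<subseteq> {x\<in>space D. (imap ^^ k) x \<le> b}"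
    using assms by auto
  ultimately show ?thesis by (simp add: cdf_def D.finite_measure_Diff)
qed

lemma cdf_0: "t \<in> {0..1} \<Longrightarrow> cdf 0 t = t"
proof -
  assume t: "t \<in> {0..1}"
  have "{x\<in>space D. (imap ^^ 0) x \<le> t} = {0<..t}" using t by (auto simp: space_D)
  then show ?thesis using measure_D_Ioc[of 0 t] t by (simp add: cdf_def)
qed

lemma cdf_Suc:
  assumes "t \<in> {0..1}"
  shows "cdf (Suc k) t = cdf k (L_inv t) + (cdf k ((1 + t) / 2) - cdf k (1/2))"
proof -
  have gt: "L_inv t \<le> 1/2" using L_inv_mono[of t 1] assms by auto
  have "{x\<in>space D. (imap ^^ Suc k) x \<le> t} = {x\<in>space D. (imap ^^ k) x \<le> L_inv t} \<union>
      {x\<in>space D. 1/2 < (imap ^^ k) x \<and> (imap ^^ k) x \<le> (1 + t) / 2}"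
    using imap_le_iff[OF imap_pow_in assms] by (auto simp: space_D)
  moreover have "{x\<in>space D. (imap ^^ k) x \<le> L_inv t} \<inter>
      {x\<in>space D. 1/2 < (imap ^^ k) x \<and> (imap ^^ k) x \<le> (1 + t) / 2} = {}"
    using gt by auto
  ultimately have "cdf (Suc k) t = cdf k (L_inv t)
      + measure D {x\<in>space D. 1/2 < (imap ^^ k) x \<and> (imap ^^ k) x \<le> (1 + t) / 2}"
    unfolding cdf_def by (simp add: D.finite_measure_Union)
  then show ?thesis using cdf_Ioc[of "1/2" "(1+t)/2" k] assms by simp
qed

text \<open>Each step composes the distribution function with the two inverse branches, which are concave and
  increasing. In other words, decreasing densities are preserved.\<close>
lemma cdf_concave: "concave_on {0..1} (cdf k)"
proof (induction k)
  case 0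
  have "concave_on {0..1::real} (\<lambda>x. x)" by (simp add: concave_on_ident)
  then show ?case using concave_on_cong[of "{0..1}" "cdf 0" "\<lambda>x. x"] cdf_0 by auto
next
  case (Suc k)
  have mono: "mono_on {0..1} (cdf k)" by (auto simp: mono_on_def cdf_mono)
  have g01: "L_inv ` {0..1} \<subseteq> {0..1}"
    using L_inv_nonneg L_inv_le by (fastforce intro: order_trans)
  have L_inv: "concave_on {0..1} L_inv"
    using L_inv_concave by (auto simp: concave_on_def intro: convex_on_subset)
  have "concave_on {0..1} (\<lambda>t. cdf k (L_inv t))"
    by (rule concave_on_compose[OF L_inv Suc mono g01])
  moreover have "concave_on {0..1} (\<lambda>t. cdf k ((1 + t) / 2))"
  proof (rule concave_on_compose[OF _ Suc mono])
    show "concave_on {0..1} (\<lambda>x::real. (1 + x) / 2)"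
      by (simp add: concave_on_iff field_simps)
  qed auto
  moreover have "concave_on {0..1} (\<lambda>t::real. - cdf k (1/2))"
    by (simp add: concave_on_const)
  ultimately have "concave_on {0..1} (\<lambda>t. cdf k (L_inv t) + (cdf k ((1 + t) / 2) + - cdf k (1/2)))"
    by (intro concave_on_add)
  then show ?case
    using concave_on_cong[of "{0..1}" "cdf (Suc k)"] cdf_Suc by auto
qed

lemma imap_pow_le_cut:
  assumes "u \<in> {0<..1}" "u \<le> cut n" "i \<le> n"
  shows "(imap ^^ i) u \<le> cut (n - i)"
  using assms(3)
proof (induction i)
  case 0 then show ?case using assms by simp
next
  case (Suc i)
  define v where "v = (imap ^^ i) u"
  have v: "v \<in> {0<..1}" "v \<le> cut (Suc (n - Suc i))"
    using Suc imap_pow_in[OF assms(1), of i] by (auto simp: v_def Suc_diff_Suc)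
  have "v \<le> 1/2" using v(2) cut_antimono[of 1 "Suc (n - Suc i)"] by auto
  then have "imap v = L v" by (simp add: imap_def)
  also have "\<dots> \<le> L (cut (Suc (n - Suc i)))" using v by (intro L_mono) auto
  finally show ?case by (simp add: v_def)
qed

text \<open>Decomposition according to the last visit to \<open>(1/2,1]\<close> up to time \<open>n\<close>. A visit at a point of
  \<open>(1/2, (1 + cut n)/2]\<close> is followed by at least \<open>n\<close> steps outside \<open>(1/2,1]\<close>, so at most one such visit
  occurs up to time \<open>n\<close>; and since the density decreases, this part of \<open>(1/2,1]\<close>, a fraction \<open>cut n\<close> of its length, carries
  at least that fraction of its mass.\<close>
lemma sum_visits_le:
  "(\<Sum>k\<le>n. 1 - cdf k (1/2)) * cut n \<le> 1"
proof -
  define A where "A k = {x\<in>space D. 1/2 < (imap ^^ k) x \<and> (imap ^^ k) x \<le> (1 + cut n) / 2}" for k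
  have disj: "A k \<inter> A k' = {}" if "k < k'" "k' \<le> n" for k k'
  proof -
    have False if x: "x \<in> A k" "x \<in> A k'" for x
    proof -
      have xs: "x \<in> {0<..1}" using x by (simp add: A_def space_D)
      have eq: "(imap ^^ Suc k) x = 2 * (imap ^^ k) x - 1"
        using x by (auto simp: A_def imap_def)
      then have "(imap ^^ Suc k) x \<le> cut n" using x by (auto simp: A_def)
      then have "(imap ^^ (k' - Suc k)) ((imap ^^ Suc k) x) \<le> cut (n - (k' - Suc k))"
        using \<open>k' \<le> n\<close> imap_pow_in[OF xs, of "Suc k"] by (intro imap_pow_le_cut) (auto simp del: greaterThanAtMost_iff)
      also have "(imap ^^ (k' - Suc k)) ((imap ^^ Suc k) x) = (imap ^^ k') x"
        using \<open>k < k'\<close> by (metis Suc_leI comp_apply funpow_add le_add_diff_inverse2)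
      also have "cut (n - (k' - Suc k)) \<le> cut 1" using that by (intro cut_antimono) (use \<open>k < k'\<close> \<open>k' \<le> n\<close> in auto)
      finally show False using x by (simp add: A_def)
    qed
    then show ?thesis by auto
  qed
  then have df: "disjoint_family_on A {..n}"
    unfolding disjoint_family_on_def by (metis Int_commute atMost_iff linorder_neqE_nat)
  have Ak: "(1 - cdf k (1/2)) * cut n \<le> measure D (A k)" for k
  proof -
    define b where "b = (1 + cut n) / 2"
    have "measure D (A k) = cdf k b - cdf k (1/2)"
      unfolding A_def b_def using cut_pos[of n] by (intro cdf_Ioc) auto
    moreover have "(cdf k 1 - cdf k b) * (b - 1/2) \<le> (cdf k b - cdf k (1/2)) * (1 - b)"
      using cut_pos[of n] cut_le_1[of n]
      by (intro concave_slopes_decreasing[OF cdf_concave]) (auto simp: b_def)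
    ultimately show ?thesis by (simp add: b_def cdf_1 field_simps)
  qed
  have "(\<Sum>k\<le>n. 1 - cdf k (1/2)) * cut n \<le> (\<Sum>k\<le>n. measure D (A k))"
    unfolding sum_distrib_right by (intro sum_mono Ak)
  also have "\<dots> = measure D (\<Union>k\<le>n. A k)"
    by (rule D.finite_measure_finite_Union[symmetric]) (auto simp: df, auto simp: A_def)
  also have "\<dots> \<le> 1" by (rule measure_D_le_1)
  finally show ?thesis .
qed

text \<open>The density near \<open>y\<close> is at most the average density on \<open>(1/2, y - r]\<close>, whose length is bounded below
  because \<open>y > 1/2\<close>.\<close>
lemma hit_prob_at:
  assumes y: "1/2 < y" "y \<le> 1" and r: "0 < r" "r \<le> (y - 1/2) / 2"
  shows "measure D {x\<in>space D. \<bar>(imap ^^ k) x - y\<bar> < r} \<le> 4 / (y - 1/2) * r * (1 - cdf k (1/2))"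
proof -
  define s b where "s = y - r" and "b = min 1 (y + r)"
  have sb: "1/2 + (y - 1/2) / 2 \<le> s" "s \<le> b" "b \<le> 1" "b - s \<le> 2 * r"
    using assms by (auto simp: s_def b_def field_simps)
  have sb': "1/2 \<le> s" using sb(1) y by (simp add: field_simps)
  then have sb'': "0 \<le> b" using sb(2) by linarith
  have "{x\<in>space D. \<bar>(imap ^^ k) x - y\<bar> < r} \<subseteq> {x\<in>space D. s < (imap ^^ k) x \<and> (imap ^^ k) x \<le> b}"
    using imap_pow_in by (fastforce simp: s_def b_def space_D)
  then have "measure D {x\<in>space D. \<bar>(imap ^^ k) x - y\<bar> < r} \<le> cdf k b - cdf k s"
    using sb by (subst cdf_Ioc[symmetric]) (auto intro!: D.finite_measure_mono)
  moreover have "(cdf k b - cdf k s) * ((y - 1/2) / 2) \<le> (1 - cdf k (1/2)) * (2 * r)"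
  proof -
    have "(cdf k b - cdf k s) * ((y - 1/2) / 2) \<le> (cdf k b - cdf k s) * (s - 1/2)"
      using sb sb' by (intro mult_left_mono) (auto simp: cdf_mono field_simps)
    also have "\<dots> \<le> (cdf k s - cdf k (1/2)) * (b - s)"
      using sb sb' sb'' by (intro concave_slopes_decreasing[OF cdf_concave]) auto
    also have "\<dots> \<le> (1 - cdf k (1/2)) * (2 * r)"
      using sb sb' r by (intro mult_mono) (auto simp: cdf_mono cdf_le_1)
    finally show ?thesis .
  qed
  then have "cdf k b - cdf k s \<le> 4 / (y - 1/2) * r * (1 - cdf k (1/2))"
    using y by (simp add: field_simps)
  ultimately show ?thesis by linarith
qed

text \<open>The expected number of visits to \<open>(1/2,1]\<close> up to time \<open>n\<close> is at most \<open>n + 1\<close> trivially, and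
  \<open>O(n\<^sup>1\<^sup>/\<^sup>\<alpha>)\<close> by \<open>sum_visits_le\<close>. The smaller of the two bounds is the one of order \<open>n\<^sup>1\<^sup>/\<^sup>\<beta>\<close>, \<open>\<beta> = max 1 \<alpha>\<close>.\<close>
lemma hit_prob:
  assumes y: "1/2 < y" "y \<le> 1"
  obtains C where "C > 0" "\<And>n r. 0 < r \<Longrightarrow> r \<le> (y - 1/2) / 2 \<Longrightarrow>
     measure D {x\<in>space D. \<exists>k\<in>{1..n}. \<bar>(imap ^^ k) x - y\<bar> < r} \<le> C * r * real (n + 1) powr (1 / max 1 \<alpha>)"
proof -
  obtain C0 where C0: "C0 > 0" "\<And>n. 1 / cut n \<le> C0 * real (n + 1) powr (1 / \<alpha>)"
    using cut_lower_bound by blast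
  define C1 where "C1 = max 1 C0"
  have visits: "(\<Sum>k\<le>n. 1 - cdf k (1/2)) \<le> C1 * real (n + 1) powr (1 / max 1 \<alpha>)" for n
  proof (cases "\<alpha> \<le> 1")
    case True
    have "(\<Sum>k\<le>n. 1 - cdf k (1/2)) \<le> (\<Sum>k\<le>n. 1)"
      by (intro sum_mono) (auto simp: cdf_def)
    also have "\<dots> \<le> C1 * real (n + 1)" by (simp add: C1_def)
    finally show ?thesis using True by (simp add: max.absorb1)
  next
    case False
    have "(\<Sum>k\<le>n. 1 - cdf k (1/2)) \<le> 1 / cut n"
      using sum_visits_le[of n] cut_pos[of n] by (simp add: field_simps)
    also have "\<dots> \<le> C0 * real (n + 1) powr (1 / \<alpha>)" by (rule C0)
    also have "\<dots> \<le> C1 * real (n + 1) powr (1 / \<alpha>)" by (intro mult_right_mono) (auto simp: C1_def)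
    finally show ?thesis using False by (simp add: max.absorb2)
  qed
  show ?thesis
  proof (rule that[of "4 / (y - 1/2) * C1"])
    show "0 < 4 / (y - 1/2) * C1" using y by (auto simp: C1_def)
    fix n r assume r: "0 < r" "r \<le> (y - 1/2) / 2"
    have "{x\<in>space D. \<exists>k\<in>{1..n}. \<bar>(imap ^^ k) x - y\<bar> < r} = (\<Union>k\<in>{1..n}. {x\<in>space D. \<bar>(imap ^^ k) x - y\<bar> < r})"
      by auto
    then have "measure D {x\<in>space D. \<exists>k\<in>{1..n}. \<bar>(imap ^^ k) x - y\<bar> < r}
       \<le> (\<Sum>k=1..n. measure D {x\<in>space D. \<bar>(imap ^^ k) x - y\<bar> < r})"
      by (simp only:) (rule D.finite_measure_subadditive_finite, auto)
    also have "\<dots> \<le> (\<Sum>k=1..n. 4 / (y - 1/2) * r * (1 - cdf k (1/2)))"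
      by (intro sum_mono hit_prob_at y r)
    also have "\<dots> \<le> (\<Sum>k\<le>n. 4 / (y - 1/2) * r * (1 - cdf k (1/2)))"
      using y r by (intro sum_mono2) (auto simp: cdf_le_1)
    also have "\<dots> = 4 / (y - 1/2) * r * (\<Sum>k\<le>n. 1 - cdf k (1/2))"
      by (simp add: sum_distrib_left)
    also have "\<dots> \<le> 4 / (y - 1/2) * r * (C1 * real (n + 1) powr (1 / max 1 \<alpha>))"
      using y r by (intro mult_left_mono visits) auto
    finally show "measure D {x\<in>space D. \<exists>k\<in>{1..n}. \<bar>(imap ^^ k) x - y\<bar> < r}
       \<le> 4 / (y - 1/2) * C1 * r * real (n + 1) powr (1 / max 1 \<alpha>)" by (simp add: mult_ac)
  qed
qed

section \<open>The jump map\<close>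

text \<open>The number of steps after which a point of \<open>(0,1]\<close> reaches \<open>(1/2,1]\<close>.\<close>
definition level :: "real \<Rightarrow> nat" where "level u = (LEAST n. cut (Suc n) < u)"

text \<open>The map iterated up to and including the first step taken from \<open>(1/2,1]\<close>. On \<open>(0,1]\<close> it is conjugate,
  through the right branch, to the first return map of \<open>(1/2,1]\<close>, but it starts directly from
  Lebesgue measure on all of \<open>(0,1]\<close>.\<close>
definition jump :: "real \<Rightarrow> real" where "jump u = 2 * (L ^^ level u) u - 1"

text \<open>The inverse of the jump map on \<open>(cut (Suc n), cut n]\<close>, where the level is \<open>n\<close>.\<close>
definition jump_inv :: "nat \<Rightarrow> real \<Rightarrow> real" where "jump_inv n t = (L_inv ^^ n) ((1 + t) / 2)"

lemma level_eq_iff: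
  assumes "u \<in> {0<..1}"
  shows "level u = n \<longleftrightarrow> cut (Suc n) < u \<and> u \<le> cut n"
proof -
  have "eventually (\<lambda>n. cut n < u) sequentially"
    using cut_tendsto_0 assms by (intro order_tendstoD) auto
  then obtain m where "cut m < u" by (auto simp: eventually_sequentially)
  then have "cut (Suc m) < u" using cut_Suc_less[of m] by linarith
  then have 1: "cut (Suc (level u)) < u" unfolding level_def by (rule LeastI)
  have 2: "u \<le> cut (level u)"
  proof (cases "level u")
    case 0 then show ?thesis using assms by simp
  next
    case (Suc j)
    then have "\<not> cut (Suc j) < u" unfolding level_def by (metis lessI not_less_Least)
    then show ?thesis using Suc by simp
  qed
  show ?thesis
  proof
    assume "cut (Suc n) < u \<and> u \<le> cut n"
    then show "level u = n"
      using 1 2 cut_antimono[of "Suc n" "level u"] cut_antimono[of "Suc (level u)" n]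
      by (cases "level u" n rule: linorder_cases) auto
  qed (use 1 2 in auto)
qed

lemma L_pow_measurable [measurable]: "(L ^^ k) \<in> borel_measurable borel"
  by (induction k) simp_all

lemma level_measurable [measurable]: "level \<in> measurable borel (count_space UNIV)"
  unfolding level_def by measurable

lemma jump_measurable [measurable]: "jump \<in> borel_measurable borel"
proof -
  have "(\<lambda>u. (L ^^ level u) u) \<in> borel_measurable borel"
    by (rule measurable_compose_countable[of "\<lambda>n u. (L ^^ n) u"]) measurable
  then show ?thesis unfolding jump_def by measurable
qed

lemma jump_pow_measurable [measurable]: "(jump ^^ k) \<in> borel_measurable borel"
  by (induction k) simp_all

lemma jump_pow_measurable_D [measurable]: "(jump ^^ k) \<in> borel_measurable D"
  by (rule borel_measurable_D) simp

lemma level_jump_pow_measurable_D [measurable]: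
  "(\<lambda>x. level ((jump ^^ k) x)) \<in> measurable D (count_space UNIV)"
  by (rule measurable_compose[OF jump_pow_measurable_D level_measurable])

lemma jump_inv_0: "jump_inv n 0 = cut (Suc n)"
  using L_inv_pow_cut[of n 1] by (simp add: jump_inv_def)

lemma jump_inv_1: "jump_inv n 1 = cut n"
  using L_inv_pow_cut[of n 0] by (simp add: jump_inv_def)

lemma jump_inv_mono: "-1 \<le> s \<Longrightarrow> s \<le> t \<Longrightarrow> jump_inv n s \<le> jump_inv n t"
  unfolding jump_inv_def by (intro L_inv_pow_mono) auto

lemma jump_inv_range:
  assumes "t \<in> {0..1}"
  shows "cut (Suc n) \<le> jump_inv n t" "jump_inv n t \<le> cut n" "jump_inv n t \<in> {0..1}"
  using jump_inv_mono[of 0 t n] jump_inv_mono[of t 1 n] assms cut_pos[of "Suc n"] cut_le_1[of n]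
  by (auto simp: jump_inv_0 jump_inv_1)

lemma jump_inv_concave: "concave_on {0..1} (jump_inv n)"
proof -
  have "concave_on {0..1} (\<lambda>t. (L_inv ^^ n) ((1 + t) / 2))"
  proof (rule concave_on_compose[OF _ L_inv_pow_concave])
    show "concave_on {0..1} (\<lambda>x::real. (1 + x) / 2)"
      by (simp add: concave_on_iff field_simps)
  qed (auto simp: mono_on_def L_inv_pow_mono)
  then show ?thesis unfolding jump_inv_def .
qed

lemma jump_le_iff:
  assumes "u \<in> {0<..1}" "t \<in> {0..1}"
  shows "jump u \<le> t \<longleftrightarrow> u \<le> jump_inv (level u) t"
proof -
  have "jump u \<le> t \<longleftrightarrow> (L ^^ level u) u \<le> (1 + t) / 2"
    unfolding jump_def by (simp add: field_simps)
  also have "\<dots> \<longleftrightarrow> u \<le> (L_inv ^^ level u) ((1 + t) / 2)"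
    using assms by (subst le_L_inv_pow_iff) auto
  finally show ?thesis unfolding jump_inv_def .
qed

lemma jump_in:
  assumes "u \<in> {0<..1}"
  shows "jump u \<in> {0<..1}"
proof -
  have "cut (Suc (level u)) < u" "u \<le> cut (level u)"
    using level_eq_iff[OF assms, of "level u"] by auto
  then show ?thesis
    using jump_le_iff[OF assms, of 0] jump_le_iff[OF assms, of 1]
    by (auto simp: jump_inv_0 jump_inv_1)
qed

lemma jump_pow_in: "x \<in> {0<..1} \<Longrightarrow> (jump ^^ k) x \<in> {0<..1}"
  by (induction k) (auto simp del: greaterThanAtMost_iff intro: jump_in)

definition jump_cdf :: "real set \<Rightarrow> nat \<Rightarrow> real \<Rightarrow> real" where
  "jump_cdf E k t = measure D {x\<in>E. (jump ^^ k) x \<le> t}"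

lemma sets_jump_sublevel:
  assumes [measurable]: "E \<in> sets D"
  shows "{x\<in>E. (jump ^^ k) x \<le> t} \<in> sets D" "{x\<in>E. s < (jump ^^ k) x \<and> (jump ^^ k) x \<le> t} \<in> sets D"
proof -
  have "{x\<in>E. (jump ^^ k) x \<le> t} = E \<inter> {x\<in>space D. (jump ^^ k) x \<le> t}"
    using sets.sets_into_space[OF assms] by auto
  then show "{x\<in>E. (jump ^^ k) x \<le> t} \<in> sets D" by simp
  have "{x\<in>E. s < (jump ^^ k) x \<and> (jump ^^ k) x \<le> t}
     = E \<inter> {x\<in>space D. s < (jump ^^ k) x \<and> (jump ^^ k) x \<le> t}"
    using sets.sets_into_space[OF assms] by auto
  then show "{x\<in>E. s < (jump ^^ k) x \<and> (jump ^^ k) x \<le> t} \<in> sets D" by simp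
qed

lemma jump_cdf_mono: "E \<in> sets D \<Longrightarrow> s \<le> t \<Longrightarrow> jump_cdf E k s \<le> jump_cdf E k t"
  unfolding jump_cdf_def by (rule D.finite_measure_mono) (auto simp: sets_jump_sublevel)

lemma jump_pow_pos_le:
  assumes "E \<in> sets D" "x \<in> E"
  shows "0 < (jump ^^ k) x" "(jump ^^ k) x \<le> 1"
proof -
  have "x \<in> {0<..1}" using assms(2) sets.sets_into_space[OF assms(1)] by (auto simp: space_D)
  from jump_pow_in[OF this, of k] show "0 < (jump ^^ k) x" "(jump ^^ k) x \<le> 1" by auto
qed

lemma jump_cdf_0:
  assumes "E \<in> sets D" shows "jump_cdf E k 0 = 0"
proof -
  have "{x\<in>E. (jump ^^ k) x \<le> 0} = {}"
    using jump_pow_pos_le(1)[OF assms, of _ k] by (auto simp: not_le)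
  then show ?thesis unfolding jump_cdf_def by (simp only: measure_empty)
qed

lemma jump_cdf_1:
  assumes "E \<in> sets D" shows "jump_cdf E k 1 = measure D E"
proof -
  have "{x\<in>E. (jump ^^ k) x \<le> 1} = E"
    using jump_pow_pos_le[OF assms, of _ k] by auto
  then show ?thesis unfolding jump_cdf_def by simp
qed

lemma jump_cdf_le_1: "jump_cdf E k t \<le> 1"
  unfolding jump_cdf_def by (rule measure_D_le_1)

lemma jump_cdf_Ioc:
  assumes "E \<in> sets D" "a \<le> b"
  shows "measure D {x\<in>E. a < (jump ^^ k) x \<and> (jump ^^ k) x \<le> b} = jump_cdf E k b - jump_cdf E k a"
proof -
  have "{x\<in>E. a < (jump ^^ k) x \<and> (jump ^^ k) x \<le> b}
      = {x\<in>E. (jump ^^ k) x \<le> b} - {x\<in>E. (jump ^^ k) x \<le> a}" by auto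
  moreover have "{x\<in>E. (jump ^^ k) x \<le> a} \<subseteq> {x\<in>E. (jump ^^ k) x \<le> b}"
    using assms by auto
  ultimately show ?thesis
    using assms by (simp add: jump_cdf_def D.finite_measure_Diff sets_jump_sublevel)
qed

text \<open>The \<open>(k+1)\<close>-st image is at most \<open>t\<close> iff the \<open>k\<close>-th image lies, for some branch \<open>n\<close>, between the left
  end of the branch and the preimage of \<open>t\<close> in it. Allowing a different set \<open>E' n\<close> on each
  branch is what the induction for \<open>jump_cdf_concave\<close> needs.\<close>
lemma jump_cdf_Suc_sums:
  assumes E': "\<And>n. E' n \<in> sets D" and E: "E = (\<Union>n. {x\<in>E' n. level ((jump ^^ k) x) = n})"
    and t: "t \<in> {0..1}"
  shows "(\<lambda>n. jump_cdf (E' n) k (jump_inv n t) - jump_cdf (E' n) k (cut (Suc n))) sums jump_cdf E (Suc k) t"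
proof -
  define A where "A n = {x\<in>E' n. cut (Suc n) < (jump ^^ k) x \<and> (jump ^^ k) x \<le> jump_inv n t}" for n
  have inI: "(jump ^^ k) x \<in> {0<..1}" if "x \<in> E' n" for x n
    using that sets.sets_into_space[OF E', of n] by (intro jump_pow_in) (auto simp: space_D)
  have A_eq: "A n = {x\<in>E' n. level ((jump ^^ k) x) = n \<and> (jump ^^ Suc k) x \<le> t}" for n
  proof -
    have "cut (Suc n) < z \<and> z \<le> jump_inv n t \<longleftrightarrow> level z = n \<and> jump z \<le> t" if "z \<in> {0<..1}" for z
      using level_eq_iff[OF that, of n] jump_le_iff[OF that t] jump_inv_range[OF t, of n] by auto
    then show ?thesis using inI unfolding A_def by auto
  qed
  have "disjoint_family A" unfolding disjoint_family_on_def A_eq by auto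
  moreover have "range A \<subseteq> sets D" using E' by (auto simp: A_def sets_jump_sublevel)
  ultimately have "(\<lambda>n. measure D (A n)) sums measure D (\<Union>n. A n)"
    by (intro D.finite_measure_UNION)
  moreover have "(\<Union>n. A n) = {x\<in>E. (jump ^^ Suc k) x \<le> t}" unfolding A_eq E by auto
  moreover have "measure D (A n) = jump_cdf (E' n) k (jump_inv n t) - jump_cdf (E' n) k (cut (Suc n))" for n
    unfolding A_def using E' jump_inv_range[OF t, of n] by (intro jump_cdf_Ioc) auto
  ultimately show ?thesis by (simp add: jump_cdf_def)
qed

corollary jump_cdf_Suc_sums_same:
  assumes "E \<in> sets D" "t \<in> {0..1}"
  shows "(\<lambda>n. jump_cdf E k (jump_inv n t) - jump_cdf E k (cut (Suc n))) sums jump_cdf E (Suc k) t"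
  using assms by (intro jump_cdf_Suc_sums) auto

definition same_itinerary :: "nat \<Rightarrow> real \<Rightarrow> real \<Rightarrow> bool" where
  "same_itinerary k x x' \<longleftrightarrow> (\<forall>i<k. level ((jump ^^ i) x) = level ((jump ^^ i) x'))"

section \<open>Conditioning on the itinerary\<close>

text \<open>The events that depend on the first \<open>k\<close> levels only, that is, the unions of cylinders of length \<open>k\<close>.\<close>
definition determined :: "nat \<Rightarrow> real set \<Rightarrow> bool" where
  "determined k E \<longleftrightarrow> E \<subseteq> {0<..1} \<and> (\<forall>x\<in>E. \<forall>x'\<in>{0<..1}. same_itinerary k x x' \<longrightarrow> x' \<in> E)"

lemma same_itinerary_sym: "same_itinerary k x x' \<Longrightarrow> same_itinerary k x' x" by (simp add: same_itinerary_def)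
lemma same_itinerary_trans: "same_itinerary k x y \<Longrightarrow> same_itinerary k y z \<Longrightarrow> same_itinerary k x z" by (simp add: same_itinerary_def)
lemma same_itinerary_refl: "same_itinerary k x x" by (simp add: same_itinerary_def)
lemma same_itinerary_Suc: "same_itinerary (Suc k) x y \<longleftrightarrow> same_itinerary k x y \<and> level ((jump ^^ k) x) = level ((jump ^^ k) y)"
  by (auto simp: same_itinerary_def less_Suc_eq)
lemma same_itinerary_shift: "same_itinerary n x y \<Longrightarrow> j + k \<le> n \<Longrightarrow> same_itinerary k ((jump ^^ j) x) ((jump ^^ j) y)"
  unfolding same_itinerary_def
proof (intro allI impI)
  fix i assume "\<forall>i<n. level ((jump ^^ i) x) = level ((jump ^^ i) y)" "j + k \<le> n" "i < k"
  then have "level ((jump ^^ (i + j)) x) = level ((jump ^^ (i + j)) y)" by auto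
  then show "level ((jump ^^ i) ((jump ^^ j) x)) = level ((jump ^^ i) ((jump ^^ j) y))"
    by (simp add: funpow_add)
qed

text \<open>An event depending on \<open>k + 1\<close> levels is decided, once the last of them is known to be \<open>n\<close>, by
  the first \<open>k\<close> levels.\<close>
lemma determined_SucE:
  assumes "determined (Suc k) E"
  obtains E' where "\<And>n. determined k (E' n)" "E = (\<Union>n. {x\<in>E' n. level ((jump ^^ k) x) = n})"
proof
  define E' where "E' n = {x\<in>{0<..1}. \<exists>x'\<in>E. same_itinerary k x x' \<and> level ((jump ^^ k) x') = n}" for n
  show "determined k (E' n)" for n
    unfolding determined_def E'_def by (blast intro: same_itinerary_trans same_itinerary_sym)
  show "E = (\<Union>n. {x\<in>E' n. level ((jump ^^ k) x) = n})"
  proof (intro subset_antisym subsetI)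
    fix x assume x: "x \<in> E"
    then have "x \<in> {0<..1}" using assms unfolding determined_def by blast
    then have "x \<in> E' (level ((jump ^^ k) x))" using x same_itinerary_refl unfolding E'_def by blast
    then show "x \<in> (\<Union>n. {x\<in>E' n. level ((jump ^^ k) x) = n})" by blast
  next
    fix x assume "x \<in> (\<Union>n. {x\<in>E' n. level ((jump ^^ k) x) = n})"
    then have "x \<in> E' (level ((jump ^^ k) x))" by auto
    then obtain x' where x: "x \<in> {0<..1}" "x' \<in> E" "same_itinerary k x x'" "level ((jump ^^ k) x') = level ((jump ^^ k) x)"
      unfolding E'_def by blast
    have "same_itinerary (Suc k) x' x" using x(4) same_itinerary_sym[OF x(3)] by (simp add: same_itinerary_Suc)
    with assms x(1,2) show "x \<in> E" unfolding determined_def by (metis (no_types))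
  qed
qed

lemma determined_0: "determined 0 E \<Longrightarrow> E = {} \<or> E = {0<..1}"
  unfolding determined_def same_itinerary_def by auto

lemma determined_sets: "determined k E \<Longrightarrow> E \<in> sets D"
proof (induction k arbitrary: E)
  case 0
  then show ?case using determined_0 sets.top[of D] by (auto simp: space_D)
next
  case (Suc k)
  from Suc.prems obtain E' where E': "\<And>n. determined k (E' n)"
    and E: "E = (\<Union>n. {x\<in>E' n. level ((jump ^^ k) x) = n})" by (rule determined_SucE) blast
  have [measurable]: "E' n \<in> sets D" for n using Suc.IH E' by auto
  have "E = (\<Union>n. E' n \<inter> {x\<in>space D. level ((jump ^^ k) x) = n})"
    using E' unfolding E determined_def space_D by blast
  then show ?case by simp
qed

text \<open>Conditioning on the past itinerary keeps the density of the present position decreasing, since it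
  amounts to following a single composition of concave inverse branches on each cylinder.\<close>
lemma jump_cdf_concave: "determined k E \<Longrightarrow> concave_on {0..1} (jump_cdf E k)"
proof (induction k arbitrary: E)
  case 0
  show ?case
  proof (cases "E = {}")
    case True
    then show ?thesis by (simp add: jump_cdf_def concave_on_const)
  next
    case False
    then have E: "E = {0<..1}" using determined_0[OF 0] by auto
    have "jump_cdf E 0 t = t" if "t \<in> {0..1}" for t
    proof -
      have "{x\<in>E. (jump ^^ 0) x \<le> t} = {0<..t}" using that by (auto simp: E)
      then show ?thesis using that measure_D_Ioc[of 0 t] by (simp add: jump_cdf_def)
    qed
    then show ?thesis using concave_on_cong[of "{0..1}" "jump_cdf E 0" "\<lambda>x. x"]
      by (auto simp: concave_on_ident)
  qed
next
  case (Suc k)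
  from Suc.prems obtain E' where E': "\<And>n. determined k (E' n)"
    and E: "E = (\<Union>n. {x\<in>E' n. level ((jump ^^ k) x) = n})" by (rule determined_SucE) blast
  have sets: "E' n \<in> sets D" for n using E' determined_sets by auto
  show ?case
  proof (rule concave_on_sums)
    show "concave_on {0..1} (\<lambda>t. jump_cdf (E' n) k (jump_inv n t) - jump_cdf (E' n) k (cut (Suc n)))" for n
    proof -
      have "concave_on {0..1} (\<lambda>t. jump_cdf (E' n) k (jump_inv n t))"
      proof (rule concave_on_compose[OF jump_inv_concave Suc.IH[OF E']])
        show "mono_on {0..1} (jump_cdf (E' n) k)" using sets by (auto simp: mono_on_def jump_cdf_mono)
        show "jump_inv n ` {0..1} \<subseteq> {0..1}" using jump_inv_range(3) by blast
      qed
      moreover have "concave_on {0..1} (\<lambda>t::real. - jump_cdf (E' n) k (cut (Suc n)))"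
        by (simp add: concave_on_const)
      ultimately have "concave_on {0..1} (\<lambda>t. jump_cdf (E' n) k (jump_inv n t) + - jump_cdf (E' n) k (cut (Suc n)))"
        by (rule concave_on_add)
      then show ?thesis by simp
    qed
    show "(\<lambda>n. jump_cdf (E' n) k (jump_inv n t) - jump_cdf (E' n) k (cut (Suc n))) sums jump_cdf E (Suc k) t" if "t \<in> {0..1}" for t
      using jump_cdf_Suc_sums[OF sets E that] .
  qed
qed

section \<open>Lower and upper bounds for the density\<close>

text \<open>A lower bound for the density of the next image, whatever the past itinerary.\<close>
definition kappa :: real where "kappa = 1 / (2 * 2 powr \<alpha>)"

lemma kappa_pos: "kappa > 0" and kappa_le: "kappa \<le> 1"
proof -
  have "2 powr \<alpha> \<ge> 1" using alpha_pos by (intro ge_one_powr_ge_zero) auto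
  then show "kappa > 0" "kappa \<le> 1" by (auto simp: kappa_def)
qed

text \<open>Bounded distortion without derivatives. The inverse branch is a restriction of the concave function
  \<^term>\<open>L_inv ^^ Suc m\<close> on \<open>[0,\<infinity>)\<close>, so its slope on \<open>[1/2,1]\<close> is at least its slope on \<open>[1, L 1]\<close>. That
  interval has length \<open>2\<^sup>\<alpha>\<close>, and its image is \<open>[cut (Suc m), cut m]\<close>.\<close>
lemma jump_inv_spread:
  assumes "0 \<le> a" "a \<le> b" "b \<le> 1"
  shows "kappa * (b - a) * (cut m - cut (Suc m)) \<le> jump_inv (Suc m) b - jump_inv (Suc m) a"
proof -
  have L1: "L 1 = 1 + 2 powr \<alpha>" by (simp add: L_def)
  have gL1: "(L_inv ^^ Suc m) (L 1) = cut m"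
    unfolding funpow_Suc_right comp_apply by (simp add: L_inv_L cut_def)
  have "((L_inv ^^ Suc m) (L 1) - (L_inv ^^ Suc m) 1) * ((1 + b) / 2 - (1 + a) / 2)
      \<le> ((L_inv ^^ Suc m) ((1 + b) / 2) - (L_inv ^^ Suc m) ((1 + a) / 2)) * (L 1 - 1)"
    using assms by (intro concave_slopes_decreasing[OF L_inv_pow_concave]) (auto simp: L1)
  then have "(cut m - cut (Suc m)) * ((b - a) / 2) \<le> (jump_inv (Suc m) b - jump_inv (Suc m) a) * 2 powr \<alpha>"
    unfolding gL1 jump_inv_def by (simp add: L1 cut_def diff_divide_distrib add_divide_distrib)
  then show ?thesis by (simp add: kappa_def field_simps)
qed

text \<open>The part of branch \<open>m + 1\<close> that lands in \<open>(a,b]\<close> has length at least \<open>kappa (b - a)\<close> times the length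
  of its right neighbour, branch \<open>m\<close>, and the decreasing density is higher there. So it carries at
  least \<open>kappa (b - a)\<close> times the mass of branch \<open>m\<close>; summing over \<open>m\<close> recovers the whole mass of \<open>E\<close>.\<close>
lemma mixing_lower_bound:
  assumes E: "determined k E" and ab: "0 \<le> a" "a \<le> b" "b \<le> 1"
  shows "kappa * (b - a) * measure D E \<le> measure D {x\<in>E. a < (jump ^^ Suc k) x \<and> (jump ^^ Suc k) x \<le> b}"
proof -
  have sE: "E \<in> sets D" using E by (rule determined_sets)
  define f where "f n = jump_cdf E k (jump_inv n b) - jump_cdf E k (jump_inv n a)" for n
  have "(\<lambda>n. (jump_cdf E k (jump_inv n b) - jump_cdf E k (cut (Suc n))) - (jump_cdf E k (jump_inv n a) - jump_cdf E k (cut (Suc n))))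
     sums (jump_cdf E (Suc k) b - jump_cdf E (Suc k) a)"
    using sE ab by (intro sums_diff jump_cdf_Suc_sums_same) auto
  then have f: "f sums (jump_cdf E (Suc k) b - jump_cdf E (Suc k) a)" by (simp add: f_def[abs_def])
  have f0: "f 0 \<ge> 0" unfolding f_def using sE ab by (simp add: jump_cdf_mono jump_inv_mono)
  have fS: "(\<lambda>m. f (Suc m)) sums (jump_cdf E (Suc k) b - jump_cdf E (Suc k) a - f 0)"
    using f by (simp add: sums_Suc_iff)
  have "(\<lambda>m. jump_cdf E k (jump_inv m 1) - jump_cdf E k (cut (Suc m))) sums jump_cdf E (Suc k) 1"
    using sE by (intro jump_cdf_Suc_sums_same) auto
  then have "(\<lambda>m. jump_cdf E k (cut m) - jump_cdf E k (cut (Suc m))) sums measure D E"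
    using sE by (simp add: jump_inv_1 jump_cdf_1)
  then have s: "(\<lambda>m. kappa * (b - a) * (jump_cdf E k (cut m) - jump_cdf E k (cut (Suc m)))) sums (kappa * (b - a) * measure D E)"
    by (rule sums_mult)
  have "kappa * (b - a) * (jump_cdf E k (cut m) - jump_cdf E k (cut (Suc m))) \<le> f (Suc m)" for m
  proof -
    define \<delta> where "\<delta> = cut m - cut (Suc m)"
    have \<delta>: "\<delta> > 0" using cut_Suc_less by (simp add: \<delta>_def)
    have "(jump_cdf E k (cut m) - jump_cdf E k (cut (Suc m))) * (jump_inv (Suc m) b - jump_inv (Suc m) a) \<le> f (Suc m) * \<delta>"
      unfolding f_def \<delta>_def
      using ab jump_inv_range[of a "Suc m"] jump_inv_range[of b "Suc m"] cut_pos[of m] cut_le_1[of m] cut_Suc_less[of m]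
      by (intro concave_slopes_decreasing[OF jump_cdf_concave[OF E]]) (auto simp: jump_inv_mono)
    moreover have "(jump_cdf E k (cut m) - jump_cdf E k (cut (Suc m))) * (kappa * (b - a) * \<delta>)
        \<le> (jump_cdf E k (cut m) - jump_cdf E k (cut (Suc m))) * (jump_inv (Suc m) b - jump_inv (Suc m) a)"
      unfolding \<delta>_def using ab sE cut_Suc_less[of m]
      by (intro mult_left_mono jump_inv_spread) (auto intro!: jump_cdf_mono)
    ultimately have "kappa * (b - a) * (jump_cdf E k (cut m) - jump_cdf E k (cut (Suc m))) * \<delta> \<le> f (Suc m) * \<delta>"
      by (simp add: algebra_simps)
    then show ?thesis using \<delta> by simp
  qed
  then have "kappa * (b - a) * measure D E \<le> jump_cdf E (Suc k) b - jump_cdf E (Suc k) a - f 0"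
    by (rule sums_le[OF _ s fS])
  then show ?thesis using f0 unfolding jump_cdf_Ioc[OF sE ab(2)] by linarith
qed

lemma determined_univ: "determined k {0<..1}" by (simp add: determined_def)

text \<open>A Lasota--Yorke argument. The density of the next image at \<open>0\<close> is a sum over the branches of the
  current density at the branch times the slope of the inverse branch. A decreasing density of mass \<open>1\<close> is at most
  \<open>1/x\<close> at \<open>x\<close>, which settles the first \<open>N\<close> branches; on the remaining ones it is bounded by \<open>M\<close>, and the sum of
  their slopes is at most \<open>1/2\<close> for \<open>N\<close> large. Thus the bound \<open>M\<close> reproduces itself.\<close>
lemma density_bound:
  obtains M where "M > 0" "\<And>k s. s \<in> {0..1} \<Longrightarrow> jump_cdf {0<..1} k s \<le> M * s"
proof -
  \<comment> \<open>\<open>Q\<close> times the length of the next branch to the left bounds the slope of an inverse branch; this uses the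
  slope on \<open>[cut 2, cut 1]\<close>, to the left of \<open>[1/2,1]\<close>.\<close>
  define Q where "Q = 1 / (2 * (cut 1 - cut 2))"
  have c2: "cut 2 < 1/2" using cut_Suc_less[of 1] by (simp add: numeral_2_eq_2)
  have Q: "Q > 0" using c2 by (simp add: Q_def)
  have "eventually (\<lambda>n. cut n < 1 / (2 * Q)) sequentially"
    using cut_tendsto_0 Q by (intro order_tendstoD) auto
  then obtain N where N: "cut (Suc N) \<le> 1 / (2 * Q)"
    by (auto simp: eventually_sequentially intro: less_imp_le)
  define M where "M = max 1 (Q / cut N)"
  have M: "M \<ge> 1" "M \<ge> Q / cut N" by (auto simp: M_def)
  define \<delta> where "\<delta> n = cut (Suc n) - cut (Suc (Suc n))" for n
  have \<delta>0: "\<delta> n \<ge> 0" for n using cut_Suc_less[of "Suc n"] by (simp add: \<delta>_def)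
  have cut_tail: "(\<lambda>n. cut (n + m)) \<longlonglongrightarrow> 0" for m
    using cut_tendsto_0 by (simp add: LIMSEQ_ignore_initial_segment)
  have \<delta>_sums: "(\<lambda>n. \<delta> (n + m)) sums cut (Suc m)" for m
    using telescope_sums'[OF cut_tail[of "Suc m"]] by (simp add: \<delta>_def)
  have \<delta>_tail: "(\<lambda>n. if n \<ge> N then \<delta> n else 0) sums cut (Suc N)"
    using sums_iff_shift[of "\<lambda>n. if n \<ge> N then \<delta> n else 0" N "cut (Suc N)"] \<delta>_sums[of N] by simp
  have jump_inv_dist: "jump_inv n s - cut (Suc n) \<le> s * Q * \<delta> n" if s: "s \<in> {0..1}" for n s
  proof -
    have "((L_inv ^^ n) ((1 + s) / 2) - (L_inv ^^ n) (1/2)) * (1/2 - cut 2)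
       \<le> ((L_inv ^^ n) (1/2) - (L_inv ^^ n) (cut 2)) * ((1 + s) / 2 - 1/2)"
      using s c2 cut_pos[of 2] by (intro concave_slopes_decreasing[OF L_inv_pow_concave]) auto
    moreover have "(L_inv ^^ n) (1/2) = cut (Suc n)" "(L_inv ^^ n) (cut 2) = cut (Suc (Suc n))"
      using L_inv_pow_cut[of n 1] L_inv_pow_cut[of n 2] by auto
    ultimately have "(jump_inv n s - cut (Suc n)) * (1/2 - cut 2) \<le> \<delta> n * (s / 2)"
      by (simp add: jump_inv_def \<delta>_def add_divide_distrib)
    then show ?thesis using c2 by (simp add: Q_def field_simps)
  qed
  have "\<forall>s\<in>{0..1}. jump_cdf {0<..1} k s \<le> M * s" for k
  proof (induction k)
    case 0
    have "jump_cdf {0<..1} 0 s \<le> M * s" if "s \<in> {0..1}" for s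
    proof -
      have "{x\<in>{0<..1}. (jump ^^ 0) x \<le> s} = {0<..s}" using that by auto
      then have "jump_cdf {0<..1} 0 s = s" using that measure_D_Ioc[of 0 s] by (simp add: jump_cdf_def)
      then show ?thesis using M(1) that mult_right_mono[of 1 M s] by auto
    qed
    then show ?case by blast
  next
    case (Suc k)
    define G where "G = jump_cdf {0<..1} k"
    have I: "{0<..1} \<in> sets D" using determined_univ determined_sets by blast
    have conc: "concave_on {0..1} G" unfolding G_def by (rule jump_cdf_concave[OF determined_univ])
    \<comment> \<open>The average density left of branch \<open>n\<close>, bounded by total mass for the first \<open>N\<close> branches and by the
    induction hypothesis for the others.\<close>
    have ratio: "G (cut (Suc n)) \<le> (1 / cut N + (if n \<ge> N then M else 0)) * cut (Suc n)" for n
    proof (cases "n \<ge> N")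
      case True
      have "G (cut (Suc n)) \<le> M * cut (Suc n)"
        using Suc cut_pos[of "Suc n"] cut_le_1[of "Suc n"] by (auto simp: G_def)
      also have "\<dots> \<le> (1 / cut N + M) * cut (Suc n)"
        using cut_pos[of N] cut_pos[of "Suc n"] by (intro mult_right_mono) auto
      finally show ?thesis using True by simp
    next
      case False
      then have "cut N \<le> cut (Suc n)" by (intro cut_antimono) auto
      then have "1 \<le> 1 / cut N * cut (Suc n)" using cut_pos[of N] by (simp add: field_simps)
      then show ?thesis using False jump_cdf_le_1[of "{0<..1}" k "cut (Suc n)"] by (simp add: G_def)
    qed
    show ?case
    proof
      fix s :: real assume s: "s \<in> {0..1}"
      have summand: "G (jump_inv n s) - G (cut (Suc n)) \<le> s * Q * (1 / cut N * \<delta> n + M * (if n \<ge> N then \<delta> n else 0))" for n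
      proof -
        define w where "w = 1 / cut N + (if n \<ge> N then M else 0)"
        have w: "w \<ge> 0" using cut_pos[of N] M by (auto simp: w_def)
        have "(G (jump_inv n s) - G (cut (Suc n))) * (cut (Suc n) - 0) \<le> (G (cut (Suc n)) - G 0) * (jump_inv n s - cut (Suc n))"
          using jump_inv_range[OF s, of n] cut_pos[of "Suc n"] by (intro concave_slopes_decreasing[OF conc]) auto
        also have "G 0 = 0" using jump_cdf_0[OF I] by (simp add: G_def)
        also have "(G (cut (Suc n)) - 0) * (jump_inv n s - cut (Suc n)) \<le> (w * cut (Suc n)) * (s * Q * \<delta> n)"
          using ratio[of n] jump_inv_dist[OF s, of n] jump_inv_range[OF s, of n] w cut_pos[of "Suc n"]
          by (intro mult_mono) (auto simp: w_def)
        finally have "(G (jump_inv n s) - G (cut (Suc n))) * cut (Suc n) \<le> (w * s * Q * \<delta> n) * cut (Suc n)"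
          by (simp add: mult_ac)
        then have "G (jump_inv n s) - G (cut (Suc n)) \<le> w * s * Q * \<delta> n"
          using cut_pos[of "Suc n"] by simp
        also have "\<dots> = s * Q * (1 / cut N * \<delta> n + M * (if n \<ge> N then \<delta> n else 0))"
          by (simp add: w_def algebra_simps)
        finally show ?thesis .
      qed
      have "(\<lambda>n. G (jump_inv n s) - G (cut (Suc n))) sums jump_cdf {0<..1} (Suc k) s"
        unfolding G_def using I s by (rule jump_cdf_Suc_sums_same)
      moreover have "(\<lambda>n. s * Q * (1 / cut N * \<delta> n + M * (if n \<ge> N then \<delta> n else 0)))
          sums (s * Q * (1 / cut N * cut (Suc 0) + M * cut (Suc N)))"
        using \<delta>_sums[of 0] \<delta>_tail by (intro sums_mult sums_add) auto
      ultimately have "jump_cdf {0<..1} (Suc k) s \<le> s * Q * (1 / cut N * cut (Suc 0) + M * cut (Suc N))"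
        by (rule sums_le[OF summand])
      also have "\<dots> = s * ((Q / cut N) / 2 + M * (Q * cut (Suc N)))"
        by (simp add: field_simps)
      also have "\<dots> \<le> s * (M / 2 + M * (1/2))"
      proof (intro mult_left_mono add_mono)
        show "Q * cut (Suc N) \<le> 1/2" using N Q by (simp add: field_simps)
      qed (use M s in auto)
      finally show "jump_cdf {0<..1} (Suc k) s \<le> M * s" by (simp add: mult_ac)
    qed
  qed
  then show ?thesis using that[of M] M by auto
qed

lemma level_prob_bound:
  obtains M where "M > 0"
    "\<And>k n. measure D {x\<in>space D. level ((jump ^^ k) x) = n} \<le> M * (cut n - cut (Suc n))"
proof -
  obtain M where M: "M > 0" "\<And>k s. s \<in> {0..1} \<Longrightarrow> jump_cdf {0<..1} k s \<le> M * s"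
    using density_bound by blast
  have I: "{0<..1} \<in> sets D" using determined_univ determined_sets by blast
  have "measure D {x\<in>space D. level ((jump ^^ k) x) = n} \<le> M * (cut n - cut (Suc n))" for k n
  proof -
    define G where "G = jump_cdf {0<..1} k"
    have "{x\<in>space D. level ((jump ^^ k) x) = n} = {x\<in>{0<..1}. cut (Suc n) < (jump ^^ k) x \<and> (jump ^^ k) x \<le> cut n}"
      using level_eq_iff[OF jump_pow_in] by (auto simp: space_D)
    then have eq: "measure D {x\<in>space D. level ((jump ^^ k) x) = n} = G (cut n) - G (cut (Suc n))"
      using jump_cdf_Ioc[OF I, of "cut (Suc n)" "cut n" k] cut_Suc_less[of n] by (simp add: G_def)
    have "(G (cut n) - G (cut (Suc n))) * (cut (Suc n) - 0) \<le> (G (cut (Suc n)) - G 0) * (cut n - cut (Suc n))"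
      unfolding G_def using cut_pos[of "Suc n"] cut_Suc_less[of n] cut_le_1[of n] cut_pos[of n]
      by (intro concave_slopes_decreasing[OF jump_cdf_concave[OF determined_univ]]) auto
    also have "\<dots> \<le> (M * cut (Suc n)) * (cut n - cut (Suc n))"
      using M(2)[of "cut (Suc n)" k] cut_pos[of "Suc n"] cut_Suc_less[of n] cut_le_1[of "Suc n"] jump_cdf_0[OF I]
      by (intro mult_right_mono) (auto simp: G_def)
    finally have "(G (cut n) - G (cut (Suc n))) * cut (Suc n) \<le> (M * (cut n - cut (Suc n))) * cut (Suc n)"
      by (simp add: mult_ac)
    then show ?thesis using cut_pos[of "Suc n"] eq by simp
  qed
  then show ?thesis using that M(1) by blast
qed

section \<open>Missing a small interval\<close>

text \<open>The jump map expands distances by a factor of at least \<open>2\<close> on each branch, the factor coming from the right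
  branch.\<close>
lemma same_itinerary_contracts:
  assumes "x \<in> {0<..1}" "y \<in> {0<..1}" "same_itinerary l x y"
  shows "\<bar>x - y\<bar> < (1/2) ^ l"
proof -
  have step: "2 * \<bar>u - v\<bar> \<le> \<bar>jump u - jump v\<bar>" if "u \<in> {0<..1}" "v \<in> {0<..1}" "level u = level v" for u v
    using that
  proof (induction u v rule: linorder_wlog)
    case (le u v)
    then show ?case using L_pow_expanding[of u v "level v"] by (auto simp: jump_def)
  next
    case (sym u v)
    then show ?case by (simp add: abs_minus_commute)
  qed
  have "2 ^ l * \<bar>x - y\<bar> \<le> \<bar>(jump ^^ l) x - (jump ^^ l) y\<bar>" using assms(3)
  proof (induction l)
    case (Suc l)
    then have "2 * (2 ^ l * \<bar>x - y\<bar>) \<le> 2 * \<bar>(jump ^^ l) x - (jump ^^ l) y\<bar>"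
      by (simp add: same_itinerary_Suc)
    also have "\<dots> \<le> \<bar>jump ((jump ^^ l) x) - jump ((jump ^^ l) y)\<bar>"
      using Suc.prems assms by (intro step jump_pow_in) (auto simp: same_itinerary_Suc)
    finally show ?case by (simp add: mult.assoc)
  qed simp
  also have "\<dots> < 1" using jump_pow_in[OF assms(1), of l] jump_pow_in[OF assms(2), of l] by (auto simp: abs_if)
  finally show ?thesis by (simp add: power_divide field_simps)
qed

text \<open>The interval \<open>(a,b]\<close> is enlarged to a union \<open>B\<close> of cylinders of length \<open>l\<close>, which stays within
  \<open>(1/2)\<^sup>l\<close> of it. Whether \<open>B\<close> is hit at time \<open>(j+1)(l+1)\<close> is then decided \<open>l\<close> levels later, just before the
  next observation, so that \<open>mixing_lower_bound\<close> applies at each observation conditionally on all earlier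
  failures.\<close>
lemma miss_prob:
  assumes ab: "0 \<le> a" "a \<le> b" "b \<le> 1"
  shows "measure D {x\<in>space D. \<forall>j<N. \<not> (a - (1/2)^l < (jump ^^ (Suc j * Suc l)) x
            \<and> (jump ^^ (Suc j * Suc l)) x < b + (1/2)^l)} \<le> exp (- (kappa * (b - a) * N))"
proof -
  define B where "B = {x\<in>{0<..1}. \<exists>z\<in>{a<..b}. same_itinerary l x z}"
  have B_saturated: "x' \<in> B" if "x \<in> B" "x' \<in> {0<..1}" "same_itinerary l x x'" for x x'
    using that unfolding B_def by (blast intro: same_itinerary_trans same_itinerary_sym)
  define E where "E i = {x\<in>{0<..1}. \<forall>j<i. (jump ^^ (Suc j * Suc l)) x \<notin> B}" for i
  have E_determined: "determined (i * Suc l + l) (E i)" for i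
    unfolding determined_def
  proof (intro conjI ballI impI)
    show "E i \<subseteq> {0<..1}" by (auto simp: E_def)
    fix x x' assume x: "x \<in> E i" "x' \<in> {0<..1}" "same_itinerary (i * Suc l + l) x x'"
    have "(jump ^^ (Suc j * Suc l)) x' \<notin> B" if j: "j < i" for j
    proof
      assume in1: "(jump ^^ (Suc j * Suc l)) x' \<in> B"
      have "Suc j * Suc l \<le> i * Suc l" using j by (intro mult_right_mono) auto
      then have "same_itinerary l ((jump ^^ (Suc j * Suc l)) x) ((jump ^^ (Suc j * Suc l)) x')"
        using x(3) by (intro same_itinerary_shift) auto
      then have "(jump ^^ (Suc j * Suc l)) x \<in> B"
        using x(1) by (intro B_saturated[OF in1 jump_pow_in same_itinerary_sym]) (auto simp: E_def)
      then show False using x(1) j by (auto simp: E_def)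
    qed
    then show "x' \<in> E i" using x(2) by (auto simp: E_def)
  qed
  have k1: "0 \<le> 1 - kappa * (b - a)"
    using kappa_pos kappa_le ab mult_mono[of kappa 1 "b - a" 1] by auto
  have step: "measure D (E (Suc i)) \<le> (1 - kappa * (b - a)) * measure D (E i)" for i
  proof -
    \<comment> \<open>The event that the first \<open>i\<close> observations fail is decided by \<open>k\<close> levels, and observation \<open>i\<close> (counted from
    \<open>0\<close>) takes place at time \<open>k + 1\<close>.\<close>
    define k where "k = i * Suc l + l"
    have Sk: "Suc k = Suc i * Suc l" by (simp add: k_def)
    define T where "T = {x\<in>E i. a < (jump ^^ Suc k) x \<and> (jump ^^ Suc k) x \<le> b}"
    have T: "T \<in> sets D" "T \<subseteq> E i" using determined_sets[OF E_determined[of i]] by (auto simp: T_def sets_jump_sublevel simp del: funpow.simps)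
    have "E (Suc i) \<subseteq> E i - T"
    proof
      fix x assume x: "x \<in> E (Suc i)"
      then have xI: "x \<in> {0<..1}" and "x \<in> E i" and nB: "(jump ^^ Suc k) x \<notin> B"
        unfolding Sk by (auto simp: E_def)
      have "(jump ^^ Suc k) x \<in> B" if "x \<in> T"
      proof -
        have "(jump ^^ Suc k) x \<in> {a<..b}" using that by (auto simp: T_def)
        then show ?thesis using jump_pow_in[OF xI, of "Suc k"] same_itinerary_refl unfolding B_def by blast
      qed
      then show "x \<in> E i - T" using \<open>x \<in> E i\<close> nB by blast
    qed
    then have "measure D (E (Suc i)) \<le> measure D (E i - T)"
      using T determined_sets[OF E_determined[of i]] by (intro D.finite_measure_mono) auto
    also have "\<dots> = measure D (E i) - measure D T"
      using T determined_sets[OF E_determined[of i]] by (intro D.finite_measure_Diff) auto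
    also have "\<dots> \<le> measure D (E i) - kappa * (b - a) * measure D (E i)"
      using mixing_lower_bound[OF E_determined[of i] ab] unfolding T_def k_def by simp
    finally show ?thesis by (simp add: algebra_simps)
  qed
  have pw: "measure D (E i) \<le> (1 - kappa * (b - a)) ^ i" for i
  proof (induction i)
    case 0
    show ?case by (simp add: measure_D_le_1)
  next
    case (Suc i)
    show ?case using order_trans[OF step mult_left_mono[OF Suc k1]] by simp
  qed
  have "{x\<in>space D. \<forall>j<N. \<not> (a - (1/2)^l < (jump ^^ (Suc j * Suc l)) x
            \<and> (jump ^^ (Suc j * Suc l)) x < b + (1/2)^l)} \<subseteq> E N"
  proof
    fix x assume x: "x \<in> {x\<in>space D. \<forall>j<N. \<not> (a - (1/2)^l < (jump ^^ (Suc j * Suc l)) x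
            \<and> (jump ^^ (Suc j * Suc l)) x < b + (1/2)^l)}"
    then have xI: "x \<in> {0<..1}" by (simp add: space_D)
    have "v \<notin> B" if v: "\<not> (a - (1/2)^l < v \<and> v < b + (1/2)^l)" for v
    proof
      assume "v \<in> B"
      then obtain z where z: "z \<in> {a<..b}" "same_itinerary l v z" "v \<in> {0<..1}" by (auto simp: B_def)
      then have "\<bar>v - z\<bar> < (1/2) ^ l" using ab by (intro same_itinerary_contracts) auto
      then show False using v z by (auto simp: abs_if split: if_splits)
    qed
    then show "x \<in> E N" using x xI unfolding E_def by blast
  qed
  then have "measure D {x\<in>space D. \<forall>j<N. \<not> (a - (1/2)^l < (jump ^^ (Suc j * Suc l)) x
            \<and> (jump ^^ (Suc j * Suc l)) x < b + (1/2)^l)} \<le> measure D (E N)"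
    using determined_sets[OF E_determined[of N]] by (intro D.finite_measure_mono) auto
  also have "\<dots> \<le> (1 - kappa * (b - a)) ^ N" by (rule pw)
  also have "\<dots> \<le> (exp (- (kappa * (b - a)))) ^ N"
    using k1 exp_ge_add_one_self[of "- (kappa * (b - a))"] by (intro power_mono) auto
  also have "\<dots> = exp (- (kappa * (b - a) * N))"
    by (simp add: exp_of_nat_mult[symmetric] mult_ac)
  finally show ?thesis .
qed

section \<open>The duration of jumps\<close>

definition jump_time :: "nat \<Rightarrow> real \<Rightarrow> nat" where "jump_time k x = (\<Sum>i<k. Suc (level ((jump ^^ i) x)))"

lemma imap_pow_eq_L_pow:
  assumes "u \<in> {0<..1}" "i \<le> level u"
  shows "(imap ^^ i) u = (L ^^ i) u"
  using assms(2)
proof (induction i)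
  case (Suc i)
  have "u \<le> cut (level u)" using level_eq_iff[OF assms(1), of "level u"] by simp
  then have "(imap ^^ i) u \<le> cut (level u - i)"
    using Suc.prems by (intro imap_pow_le_cut assms) auto
  also have "\<dots> \<le> cut 1" using Suc.prems by (intro cut_antimono) auto
  finally have "(imap ^^ i) u \<le> 1/2" by simp
  then have "imap ((imap ^^ i) u) = L ((imap ^^ i) u)" by (simp add: imap_def)
  then show ?case using Suc by simp
qed simp

lemma imap_pow_level:
  assumes "u \<in> {0<..1}"
  shows "(imap ^^ level u) u = (1 + jump u) / 2" "(imap ^^ Suc (level u)) u = jump u"
proof -
  show 1: "(imap ^^ level u) u = (1 + jump u) / 2"
    using imap_pow_eq_L_pow[OF assms order_refl] by (simp add: jump_def)
  show "(imap ^^ Suc (level u)) u = jump u"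
    using jump_in[OF assms] by (simp add: 1 imap_def field_simps)
qed

lemma imap_pow_jump_time:
  assumes "x \<in> {0<..1}"
  shows "(imap ^^ jump_time k x) x = (jump ^^ k) x"
proof (induction k)
  case (Suc k)
  have "jump_time (Suc k) x = Suc (level ((jump ^^ k) x)) + jump_time k x" by (simp add: jump_time_def)
  then have "(imap ^^ jump_time (Suc k) x) x = (imap ^^ Suc (level ((jump ^^ k) x))) ((imap ^^ jump_time k x) x)"
    by (simp add: funpow_add)
  also have "\<dots> = jump ((jump ^^ k) x)"
    unfolding Suc by (rule imap_pow_level[OF jump_pow_in[OF assms]])
  finally show ?case by simp
qed (simp add: jump_time_def)

lemma jump_time_ge: "k \<le> jump_time k x"
proof -
  have "(\<Sum>i<k. 1) \<le> jump_time k x" unfolding jump_time_def by (intro sum_mono) auto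
  then show ?thesis by simp
qed

text \<open>One step before the end of a jump, the orbit is at the preimage of the image point under the right
  branch. The hypothesis \<open>2 \<le> k\<close> makes that time positive even if the first jump takes a single step.\<close>
lemma hit_from_jump:
  assumes x: "x \<in> {0<..1}" and k: "2 \<le> k" and h: "\<bar>(jump ^^ k) x - (2 * y - 1)\<bar> < 2 * r"
  shows "\<exists>m\<ge>1. m \<le> jump_time k x \<and> \<bar>(imap ^^ m) x - y\<bar> < r"
proof -
  obtain k' where k': "k = Suc k'" "1 \<le> k'" using k by (cases k) auto
  define m where "m = level ((jump ^^ k') x) + jump_time k' x"
  have "(imap ^^ m) x = (imap ^^ level ((jump ^^ k') x)) ((imap ^^ jump_time k' x) x)"
    by (simp add: m_def funpow_add)
  also have "\<dots> = (1 + jump ((jump ^^ k') x)) / 2"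
    unfolding imap_pow_jump_time[OF x] by (rule imap_pow_level[OF jump_pow_in[OF x]])
  finally have "(imap ^^ m) x = (1 + (jump ^^ k) x) / 2" by (simp add: k')
  then have "\<bar>(imap ^^ m) x - y\<bar> < r" using h by (simp add: abs_if field_simps split: if_splits)
  moreover have "m \<le> jump_time k x" "1 \<le> m" using k' jump_time_ge[of k' x] by (auto simp: m_def jump_time_def)
  ultimately show ?thesis by blast
qed

lemma nn_integral_level:
  "(\<integral>\<^sup>+x. f (level ((jump ^^ k) x)) \<partial>D)
     = (\<Sum>n. f n * emeasure D {x\<in>space D. level ((jump ^^ k) x) = n})"
proof -
  have "(\<integral>\<^sup>+x. f (level ((jump ^^ k) x)) \<partial>D)
      = (\<integral>\<^sup>+x. (\<Sum>n. f n * indicator {x\<in>space D. level ((jump ^^ k) x) = n} x) \<partial>D)"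
  proof (rule nn_integral_cong)
    fix x assume x: "x \<in> space D"
    have "(\<lambda>n. f n * indicator {x\<in>space D. level ((jump ^^ k) x) = n} x)
       = (\<lambda>n. if n = level ((jump ^^ k) x) then f n else 0)"
      using x by (auto simp: indicator_def)
    then show "f (level ((jump ^^ k) x)) = (\<Sum>n. f n * indicator {x\<in>space D. level ((jump ^^ k) x) = n} x)"
      using sums_single[of "level ((jump ^^ k) x)" f] by (simp add: sums_iff)
  qed
  also have "\<dots> = (\<Sum>n. \<integral>\<^sup>+x. f n * indicator {x\<in>space D. level ((jump ^^ k) x) = n} x \<partial>D)"
    by (rule nn_integral_suminf) measurable
  also have "\<dots> = (\<Sum>n. f n * emeasure D {x\<in>space D. level ((jump ^^ k) x) = n})"
    by (simp add: nn_integral_cmult_indicator)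
  finally show ?thesis .
qed

lemma moment_bound:
  assumes "p < 1 / \<alpha>"
  obtains C where "C \<ge> 0"
    "\<And>k. (\<integral>\<^sup>+x. ennreal (real (Suc (level ((jump ^^ k) x))) powr p) \<partial>D) \<le> ennreal C"
proof -
  obtain M where M: "M > 0"
    "\<And>k n. measure D {x\<in>space D. level ((jump ^^ k) x) = n} \<le> M * (cut n - cut (Suc n))"
    using level_prob_bound by blast
  define f where "f n = real (n + 1) powr p * (cut n - cut (Suc n))" for n
  have f0: "f n \<ge> 0" for n using cut_Suc_less[of n] by (simp add: f_def)
  have sf: "summable (\<lambda>n. M * f n)"
    unfolding f_def by (intro summable_mult summable_moment_cut assms)
  have "(\<integral>\<^sup>+x. ennreal (real (Suc (level ((jump ^^ k) x))) powr p) \<partial>D) \<le> ennreal (\<Sum>n. M * f n)" for k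
  proof -
    have "(\<integral>\<^sup>+x. ennreal (real (Suc (level ((jump ^^ k) x))) powr p) \<partial>D)
        = (\<Sum>n. ennreal (real (Suc n) powr p) * emeasure D {x\<in>space D. level ((jump ^^ k) x) = n})"
      by (rule nn_integral_level)
    also have "\<dots> \<le> (\<Sum>n. ennreal (M * f n))"
    proof (rule suminf_le)
      fix n
      have "ennreal (real (Suc n) powr p) * emeasure D {x\<in>space D. level ((jump ^^ k) x) = n}
         = ennreal (real (Suc n) powr p * measure D {x\<in>space D. level ((jump ^^ k) x) = n})"
        by (simp add: D.emeasure_eq_measure ennreal_mult)
      also have "\<dots> \<le> ennreal (real (Suc n) powr p * (M * (cut n - cut (Suc n))))"
        by (intro ennreal_leI mult_left_mono M(2)) auto
      also have "real (Suc n) powr p * (M * (cut n - cut (Suc n))) = M * f n"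
        by (simp add: f_def)
      finally show "ennreal (real (Suc n) powr p) * emeasure D {x\<in>space D. level ((jump ^^ k) x) = n} \<le> ennreal (M * f n)" .
    qed auto
    also have "\<dots> = ennreal (\<Sum>n. M * f n)"
      using sf f0 M(1) by (intro suminf_ennreal2) auto
    finally show ?thesis .
  qed
  moreover have "(\<Sum>n. M * f n) \<ge> 0" using sf f0 M(1) by (intro suminf_nonneg) auto
  ultimately show ?thesis using that by blast
qed

text \<open>For \<open>p \<le> 1\<close> the \<open>p\<close>-th power is subadditive, so it suffices to control the sum of the \<open>p\<close>-th powers of
  the durations. Their expectations are bounded, hence the series weighted by \<open>(i+1)\<^sup>-\<^sup>1\<^sup>-\<^sup>\<epsilon>\<close> has finite
  expectation and converges almost surely.\<close>
lemma AE_jump_time_growth: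
  assumes p: "0 < p" "p \<le> 1" "p < 1 / \<alpha>" and e: "\<epsilon> > 0"
  shows "AE x in D. \<exists>C\<ge>0. \<forall>K. real (jump_time K x) powr p \<le> C * real K powr (1 + \<epsilon>)"
proof -
  obtain C where C: "C \<ge> 0"
    "\<And>k. (\<integral>\<^sup>+x. ennreal (real (Suc (level ((jump ^^ k) x))) powr p) \<partial>D) \<le> ennreal C"
    using moment_bound[OF p(3)] by blast
  define w where "w i = real (Suc i) powr (- (1 + \<epsilon>))" for i
  have w0: "w i > 0" for i by (simp add: w_def)
  have sw: "summable (\<lambda>i. w i * C)"
  proof -
    have "summable (\<lambda>n. real n powr (- (1 + \<epsilon>)))"
      using e by (subst summable_real_powr_iff) auto
    then have "summable w" unfolding w_def
      using summable_Suc_iff[of "\<lambda>n. real n powr (- (1 + \<epsilon>))"] by simp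
    then show ?thesis by (rule summable_mult2)
  qed
  define R where "R i x = real (Suc (level ((jump ^^ i) x))) powr p" for i x
  define W where "W x = (\<Sum>i. ennreal (w i) * ennreal (R i x))" for x
  have [measurable]: "R i \<in> borel_measurable D" for i
    unfolding R_def by measurable
  have Wm [measurable]: "W \<in> borel_measurable D" unfolding W_def by measurable
  have "(\<integral>\<^sup>+x. W x \<partial>D) = (\<Sum>i. \<integral>\<^sup>+x. ennreal (w i) * ennreal (R i x) \<partial>D)"
    unfolding W_def by (rule nn_integral_suminf) measurable
  also have "\<dots> = (\<Sum>i. ennreal (w i) * (\<integral>\<^sup>+x. ennreal (R i x) \<partial>D))"
    by (simp add: nn_integral_cmult)
  also have "\<dots> \<le> (\<Sum>i. ennreal (w i * C))"
  proof (rule suminf_le)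
    fix i
    have "ennreal (w i) * (\<integral>\<^sup>+x. ennreal (R i x) \<partial>D) \<le> ennreal (w i) * ennreal C"
      unfolding R_def by (intro mult_left_mono C) auto
    then show "ennreal (w i) * (\<integral>\<^sup>+x. ennreal (R i x) \<partial>D) \<le> ennreal (w i * C)"
      using w0[of i] C(1) by (simp add: ennreal_mult less_imp_le)
  qed auto
  also have "\<dots> = ennreal (\<Sum>i. w i * C)"
    using sw C(1) w0 by (intro suminf_ennreal2) (auto simp: less_imp_le)
  finally have "(\<integral>\<^sup>+x. W x \<partial>D) \<noteq> \<infinity>" by (auto simp: top_unique)
  then have "AE x in D. W x \<noteq> \<infinity>" by (intro nn_integral_PInf_AE Wm)
  then show ?thesis
  proof eventually_elim
    case (elim x)
    then obtain V where V: "W x = ennreal V" "V \<ge> 0" by (cases "W x") auto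
    have "real (jump_time K x) powr p \<le> V * real K powr (1 + \<epsilon>)" for K
    proof -
      have "ennreal (\<Sum>i<K. w i * R i x) = (\<Sum>i<K. ennreal (w i) * ennreal (R i x))"
        using w0 by (simp add: ennreal_mult less_imp_le R_def flip: sum_ennreal)
      also have "\<dots> \<le> W x" unfolding W_def by (intro sum_le_suminf) auto
      finally have 1: "(\<Sum>i<K. w i * R i x) \<le> V" using V by (simp add: ennreal_le_iff)
      have "real (jump_time K x) powr p \<le> (\<Sum>i<K. R i x)"
        unfolding jump_time_def R_def of_nat_sum by (rule powr_sum_le_sum_powr) (use p in auto)
      also have "\<dots> \<le> (\<Sum>i<K. real K powr (1 + \<epsilon>) * (w i * R i x))"
      proof (rule sum_mono)
        fix i assume "i \<in> {..<K}"
        then have "1 \<le> real K / real (Suc i)" by simp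
        then have "1 \<le> (real K / real (Suc i)) powr (1 + \<epsilon>)"
          using e by (intro ge_one_powr_ge_zero) auto
        also have "\<dots> = real K powr (1 + \<epsilon>) * w i"
          by (simp only: w_def powr_divide powr_minus_divide) (simp add: powr_divide)
        finally have "1 * R i x \<le> real K powr (1 + \<epsilon>) * w i * R i x"
          by (intro mult_right_mono) (auto simp: R_def)
        then show "R i x \<le> real K powr (1 + \<epsilon>) * (w i * R i x)" by (simp add: mult_ac)
      qed
      also have "\<dots> = real K powr (1 + \<epsilon>) * (\<Sum>i<K. w i * R i x)"
        by (simp add: sum_distrib_left)
      also have "\<dots> \<le> real K powr (1 + \<epsilon>) * V" using 1 by (intro mult_left_mono) auto
      finally show ?thesis by (simp add: mult_ac)
    qed
    then show ?case using V(2) by blast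
  qed
qed

section \<open>Almost sure bounds along dyadic radii\<close>

lemma borel_cantelli_D:
  assumes "\<And>j. A j \<in> sets D" "summable q" "\<And>j. j \<ge> j0 \<Longrightarrow> measure D (A j) \<le> q j"
  shows "AE x in D. eventually (\<lambda>j. x \<notin> A j) sequentially"
proof -
  have "summable (\<lambda>j. q (j + j0))" using assms(2) by (rule summable_ignore_initial_segment)
  then have "summable (\<lambda>j. measure D (A (j + j0)))"
    by (rule summable_comparison_test') (use assms(3) in auto)
  then have "AE x in D. eventually (\<lambda>j. x \<in> space D - A (j + j0)) sequentially"
    by (intro borel_cantelli_AE1) (use assms(1) in \<open>auto simp: D.emeasure_eq_measure\<close>)
  then show ?thesis
  proof eventually_elim
    case (elim x)
    then have "eventually (\<lambda>j. x \<notin> A (j + j0)) sequentially"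
      by (rule eventually_mono) auto
    then show ?case by (rule eventually_sequentially_seg[THEN iffD1])
  qed
qed

lemma eventually_half_power_le:
  assumes "z > (0::real)"
  obtains j0 where "\<And>j. j \<ge> j0 \<Longrightarrow> (1/2) ^ j \<le> z"
proof -
  have "(\<lambda>j. (1/2::real) ^ j) \<longlonglongrightarrow> 0" by (rule LIMSEQ_realpow_zero) auto
  then have "eventually (\<lambda>j. (1/2::real) ^ j < z) sequentially"
    using assms by (rule order_tendstoD)
  then show ?thesis using that by (auto simp: eventually_sequentially intro: less_imp_le)
qed

text \<open>Observing \<open>j 2\<^sup>j\<close> times an interval of length \<open>2\<^sup>-\<^sup>j\<close> leaves a miss probability of at most
  \<open>exp (- kappa j)\<close>, which is summable. The interval lies to the left of \<open>z\<close>, so that it stays inside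
  \<open>(0,1]\<close> when \<open>z = 1\<close>.\<close>
lemma AE_jump_hits:
  assumes y: "0 < z" "z \<le> 1"
  shows "AE x in D. eventually (\<lambda>j. \<exists>k\<ge>2. k \<le> j * 2 ^ j * Suc j \<and> \<bar>(jump ^^ k) x - z\<bar> < 2 * (1/2) ^ j) sequentially"
proof -
  define A where "A j = {x\<in>space D. \<forall>i<j * 2 ^ j. \<not> (z - (1/2)^j - (1/2)^j < (jump ^^ (Suc i * Suc j)) x
            \<and> (jump ^^ (Suc i * Suc j)) x < z + (1/2)^j)}" for j
  have Am: "A j \<in> sets D" for j unfolding A_def by measurable
  obtain j0 where j0: "\<And>j. j \<ge> j0 \<Longrightarrow> (1/2) ^ j \<le> z"
    using eventually_half_power_le[OF y(1)] by blast
  have "measure D (A j) \<le> exp (- kappa) ^ j" if "j \<ge> j0" for j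
  proof -
    have "measure D (A j) \<le> exp (- (kappa * (z - (z - (1/2)^j)) * real (j * 2 ^ j)))"
      unfolding A_def using j0[OF that] y by (intro miss_prob) auto
    also have "kappa * (z - (z - (1/2)^j)) * real (j * 2 ^ j) = real j * kappa"
      by (simp add: power_divide)
    finally show ?thesis by (simp add: exp_of_nat_mult[symmetric])
  qed
  moreover have "summable (\<lambda>j. exp (- kappa) ^ j)"
    using kappa_pos by (intro summable_geometric) auto
  ultimately have "AE x in D. eventually (\<lambda>j. x \<notin> A j) sequentially"
    by (intro borel_cantelli_D[OF Am])
  then show ?thesis using AE_space
  proof eventually_elim
    case (elim x)
    from elim(1) eventually_ge_at_top[of 1] show ?case
    proof eventually_elim
      case (elim j)
      then obtain i where i: "i < j * 2 ^ j" "z - (1/2)^j - (1/2)^j < (jump ^^ (Suc i * Suc j)) x"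
        "(jump ^^ (Suc i * Suc j)) x < z + (1/2)^j"
        using \<open>x \<in> space D\<close> unfolding A_def by blast
      have a: "2 \<le> Suc i * Suc j"
        using \<open>1 \<le> j\<close> by (cases j) auto
      have b: "Suc i * Suc j \<le> j * 2 ^ j * Suc j"
        using i(1) by (intro mult_right_mono) auto
      have "(0::real) < (1/2) ^ j" by simp
      then have "\<bar>(jump ^^ (Suc i * Suc j)) x - z\<bar> < 2 * (1/2) ^ j"
        using i(2,3) by linarith
      then show ?case using a b by blast
    qed
  qed
qed

definition beta :: real where "beta = max 1 \<alpha>"

lemma beta_ge: "beta \<ge> 1" "beta \<ge> \<alpha>" by (auto simp: beta_def)

lemma poly_exp_eventually_le:
  assumes "C \<ge> 0" "e > 0" "d > 0"
  shows "eventually (\<lambda>j. C * (real j * (real j + 1)) powr e \<le> 2 powr (d * real j)) sequentially"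
proof -
  have "(\<lambda>j::nat. (C * (real j * (real j + 1)) powr e) / 2 powr (d * real j)) \<longlonglongrightarrow> 0"
    using assms by real_asymp
  then have "eventually (\<lambda>j. (C * (real j * (real j + 1)) powr e) / 2 powr (d * real j) < 1) sequentially"
    by (rule order_tendstoD) auto
  then show ?thesis by (rule eventually_mono) (simp add: field_simps)
qed

text \<open>The target is hit within about \<open>2\<^sup>j\<close> jumps up to a polynomial factor in \<open>j\<close>, and \<open>K\<close> jumps last at most about
  \<open>K\<^sup>1\<^sup>/\<^sup>p\<close> steps for every \<open>p < 1/\<beta>\<close>.\<close>
lemma AE_hit_upper:
  assumes y: "1/2 < y" "y \<le> 1" and \<delta>: "\<delta> > 0"
  shows "AE x in D. eventually (\<lambda>j. \<exists>m\<ge>1. \<bar>(imap ^^ m) x - y\<bar> < (1/2) ^ j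
            \<and> real m \<le> 2 powr (real j * (beta + \<delta>))) sequentially"
proof -
  \<comment> \<open>An order strictly below \<open>1/\<beta>\<close>, and an \<open>\<epsilon>\<close> for which half of the excess \<open>p (\<beta> + \<delta>) - 1\<close> remains to absorb the
  polynomial factor in \<open>j\<close>.\<close>
  define p where "p = 1 / (beta + \<delta> / 2)"
  define \<epsilon> where "\<epsilon> = p * \<delta> / 4"
  have bd: "0 < beta + \<delta> / 2" "1 \<le> beta + \<delta> / 2" "\<alpha> < beta + \<delta> / 2" using beta_ge \<delta> by auto
  have p: "0 < p" "p \<le> 1" "p < 1 / \<alpha>"
    using bd alpha_pos by (auto simp: p_def field_simps)
  have e: "\<epsilon> > 0" using p \<delta> by (simp add: \<epsilon>_def)
  have pe: "p * (beta + \<delta>) = 1 + 2 * \<epsilon>"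
    using bd by (simp add: p_def \<epsilon>_def field_simps)
  have "AE x in D. eventually (\<lambda>j. \<exists>k\<ge>2. k \<le> j * 2 ^ j * Suc j
      \<and> \<bar>(jump ^^ k) x - (2 * y - 1)\<bar> < 2 * (1/2) ^ j) sequentially"
    using y by (intro AE_jump_hits) auto
  then show ?thesis using AE_jump_time_growth[OF p e] AE_space
  proof eventually_elim
    case (elim x)
    then have x: "x \<in> {0<..1}" by (simp add: space_D)
    from elim(2) obtain C where C: "C \<ge> 0" "\<And>K. real (jump_time K x) powr p \<le> C * real K powr (1 + \<epsilon>)" by blast
    have ev: "eventually (\<lambda>j. C * (real j * (real j + 1)) powr (1 + \<epsilon>) \<le> 2 powr (\<epsilon> * real j)) sequentially"
      using C(1) e by (intro poly_exp_eventually_le) auto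
    from elim(1) ev show ?case
    proof eventually_elim
      case (elim j)
      then obtain k where k: "k \<ge> 2" "k \<le> j * 2 ^ j * Suc j"
        "\<bar>(jump ^^ k) x - (2 * y - 1)\<bar> < 2 * (1/2) ^ j" by blast
      obtain m where m: "m \<ge> 1" "m \<le> jump_time k x" "\<bar>(imap ^^ m) x - y\<bar> < (1/2) ^ j"
        using hit_from_jump[OF x k(1,3)] by blast
      have "real m powr p \<le> real (jump_time k x) powr p"
        using m p by (intro powr_mono2) auto
      also have "\<dots> \<le> C * real k powr (1 + \<epsilon>)" by (rule C)
      also have "\<dots> \<le> C * real (j * 2 ^ j * Suc j) powr (1 + \<epsilon>)"
        using C(1) k(2) e by (intro mult_left_mono powr_mono2) (auto simp flip: of_nat_mult of_nat_power)
      also have "real (j * 2 ^ j * Suc j) = (real j * (real j + 1)) * 2 powr real j"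
        by (simp add: powr_realpow algebra_simps)
      also have "C * ((real j * (real j + 1)) * 2 powr real j) powr (1 + \<epsilon>)
          = (C * (real j * (real j + 1)) powr (1 + \<epsilon>)) * 2 powr (real j * (1 + \<epsilon>))"
        by (subst powr_mult) (auto simp: powr_powr)
      also have "\<dots> \<le> 2 powr (\<epsilon> * real j) * 2 powr (real j * (1 + \<epsilon>))"
        using elim(2) by (intro mult_right_mono) auto
      also have "\<dots> = 2 powr (real j * (p * (beta + \<delta>)))"
        unfolding pe by (simp add: algebra_simps flip: powr_add)
      also have "\<dots> = (2 powr (real j * (beta + \<delta>))) powr p"
        by (simp add: powr_powr mult_ac)
      finally have "real m powr p \<le> (2 powr (real j * (beta + \<delta>))) powr p" .
      then have "real m \<le> 2 powr (real j * (beta + \<delta>))"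
        using p(1) powr_less_mono2[OF p(1), of "2 powr (real j * (beta + \<delta>))" "real m"]
        by (meson not_le powr_ge_zero)
      then show ?case using m by blast
    qed
  qed
qed

text \<open>Up to time \<open>n = 2\<close> to the power \<open>j(\<beta> - \<delta>)\<close> the ball of radius \<open>2\<^sup>-\<^sup>j\<close> is hit with probability
  \<open>O(2\<^sup>-\<^sup>j n\<^sup>1\<^sup>/\<^sup>\<beta>)\<close>, which decays geometrically in \<open>j\<close>.\<close>
lemma AE_hit_lower:
  assumes y: "1/2 < y" "y \<le> 1" and \<delta>: "0 < \<delta>" "\<delta> \<le> beta"
  shows "AE x in D. eventually (\<lambda>j. \<forall>m\<ge>1. \<bar>(imap ^^ m) x - y\<bar> < (1/2) ^ j
            \<longrightarrow> 2 powr (real j * (beta - \<delta>)) \<le> real m) sequentially"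
proof -
  obtain C where C: "C > 0" "\<And>n r. 0 < r \<Longrightarrow> r \<le> (y - 1/2) / 2 \<Longrightarrow>
     measure D {x\<in>space D. \<exists>k\<in>{1..n}. \<bar>(imap ^^ k) x - y\<bar> < r} \<le> C * r * real (n + 1) powr (1 / beta)"
    using hit_prob[OF y] unfolding beta_def by blast
  define n where "n j = nat \<lfloor>2 powr (real j * (beta - \<delta>))\<rfloor>" for j :: nat
  define A where "A j = {x\<in>space D. \<exists>k\<in>{1..n j}. \<bar>(imap ^^ k) x - y\<bar> < (1/2) ^ j}" for j
  have Am: "A j \<in> sets D" for j unfolding A_def by measurable
  have "0 < (y - 1/2) / 2" using y by auto
  then obtain j0 where j0: "\<And>j. j \<ge> j0 \<Longrightarrow> (1/2) ^ j \<le> (y - 1/2) / 2"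
    using eventually_half_power_le by blast
  define q where "q j = C * 2 powr (1 / beta) * (2 powr (- \<delta> / beta)) ^ j" for j :: nat
  have "measure D (A j) \<le> q j" if "j \<ge> j0" for j
  proof -
    have g1: "1 \<le> 2 powr (real j * (beta - \<delta>))" using \<delta> by (intro ge_one_powr_ge_zero) auto
    have "real (n j) \<le> 2 powr (real j * (beta - \<delta>))" using g1 by (simp add: n_def)
    then have n1: "real (n j + 1) \<le> 2 * 2 powr (real j * (beta - \<delta>))" using g1 by simp
    have "measure D (A j) \<le> C * (1/2) ^ j * real (n j + 1) powr (1 / beta)"
      unfolding A_def using j0[OF that] by (intro C(2)) auto
    also have "\<dots> \<le> C * (1/2) ^ j * (2 * 2 powr (real j * (beta - \<delta>))) powr (1 / beta)"
      using C(1) n1 beta_ge by (intro mult_left_mono powr_mono2) auto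
    also have "(2 * 2 powr (real j * (beta - \<delta>))) powr (1 / beta) = 2 powr (1 / beta) * 2 powr (real j * (1 - \<delta> / beta))"
      using beta_ge by (simp add: powr_mult powr_powr field_simps)
    also have "C * (1/2) ^ j * (2 powr (1 / beta) * 2 powr (real j * (1 - \<delta> / beta)))
       = C * 2 powr (1 / beta) * (2 powr (- real j) * 2 powr (real j * (1 - \<delta> / beta)))"
      by (simp add: powr_minus powr_realpow power_one_over inverse_eq_divide)
    also have "2 powr (- real j) * 2 powr (real j * (1 - \<delta> / beta)) = 2 powr (real j * (- \<delta> / beta))"
      by (simp add: algebra_simps flip: powr_add)
    also have "\<dots> = (2 powr (- \<delta> / beta)) ^ j"
      by (simp add: powr_realpow[symmetric] powr_powr mult.commute)
    finally show ?thesis by (simp add: q_def)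
  qed
  moreover have "summable q"
  proof -
    have "2 powr (- \<delta> / beta) < 2 powr 0"
      using \<delta> beta_ge by (intro powr_less_mono) auto
    then have "summable (\<lambda>j. (2 powr (- \<delta> / beta)) ^ j)" by (intro summable_geometric) auto
    then show ?thesis unfolding q_def by (rule summable_mult)
  qed
  ultimately have "AE x in D. eventually (\<lambda>j. x \<notin> A j) sequentially"
    by (intro borel_cantelli_D[OF Am])
  then show ?thesis using AE_space
  proof eventually_elim
    case (elim x)
    from elim(1) show ?case
    proof (rule eventually_mono, intro allI impI)
      fix j m assume "x \<notin> A j" "1 \<le> m" "\<bar>(imap ^^ m) x - y\<bar> < (1/2) ^ j"
      then have "\<not> m \<le> n j" using elim(2) by (auto simp: A_def)
      then have "n j < m" by simp
      then have "\<lfloor>2 powr (real j * (beta - \<delta>))\<rfloor> < int m" unfolding n_def by linarith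
      then show "2 powr (real j * (beta - \<delta>)) \<le> real m" by linarith
    qed
  qed
qed

lemma countable_imap_vimage:
  "countable T \<Longrightarrow> countable {x\<in>{0<..1}. (imap ^^ k) x \<in> T}"
proof (induction k arbitrary: T)
  case 0
  then show ?case by (rule countable_subset[rotated]) auto
next
  case (Suc k)
  \<comment> \<open>The preimage of \<open>T\<close> under one step, through each of the two inverse branches.\<close>
  define T' where "T' = L_inv ` T \<union> (\<lambda>t. (1 + t) / 2) ` T"
  have "countable T'" using Suc.prems by (simp add: T'_def)
  have "z \<in> T'" if "z \<in> {0<..1}" "imap z \<in> T" for z
  proof (cases "z \<le> 1/2")
    case True
    then have "L_inv (imap z) = z" using that by (simp add: imap_def L_inv_L)
    then have "z \<in> L_inv ` T" using that(2) by (metis imageI)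
    then show ?thesis by (simp add: T'_def)
  next
    case False
    then have "z = (1 + imap z) / 2" by (simp add: imap_def)
    then have "z \<in> (\<lambda>t. (1 + t) / 2) ` T" using that(2) by (rule image_eqI)
    then show ?thesis by (simp add: T'_def)
  qed
  then have "{x\<in>{0<..1}. (imap ^^ Suc k) x \<in> T} \<subseteq> {x\<in>{0<..1}. (imap ^^ k) x \<in> T'}"
    using imap_pow_in by auto
  then show ?case using Suc.IH[OF \<open>countable T'\<close>] by (rule countable_subset)
qed

lemma AE_imap_eq: "AE x in D. \<forall>k. (intermittent_map \<alpha> ^^ k) x = (imap ^^ k) x"
proof -
  define N where "N = (\<Union>k. {x\<in>{0<..1}. (imap ^^ k) x \<in> {1/2}})"
  have "countable N" unfolding N_def by (intro countable_UN countable_imap_vimage) auto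
  then have "AE x in lborel. x \<notin> N" by (intro AE_not_in countable_imp_null_set_lborel)
  then have "AE x in D. x \<notin> N" unfolding D_def by (subst AE_restrict_space_iff) auto
  then show ?thesis using AE_space
  proof eventually_elim
    case (elim x)
    have "(intermittent_map \<alpha> ^^ k) x = (imap ^^ k) x" for k
    proof (induction k)
      case (Suc k)
      have "(imap ^^ k) x \<noteq> 1/2" using elim by (auto simp: N_def space_D)
      then have "intermittent_map \<alpha> ((imap ^^ k) x) = imap ((imap ^^ k) x)"
        by (auto simp: intermittent_map_def imap_def L_def)
      then show ?case using Suc by simp
    qed simp
    then show ?case by blast
  qed
qed

end

section \<open>The limit\<close>

lemma hitting_time_le: "1 \<le> m \<Longrightarrow> (f ^^ m) x \<in> ball y r \<Longrightarrow> hitting_time f x y r \<le> enat m"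
  unfolding hitting_time_def by (intro Inf_lower) auto

lemma hitting_time_attained:
  assumes "hitting_time f x y r = enat m"
  shows "1 \<le> m \<and> (f ^^ m) x \<in> ball y r"
proof -
  have "{n. n > 0 \<and> (f ^^ n) x \<in> ball y r} \<noteq> {}"
  proof
    assume "{n. n > 0 \<and> (f ^^ n) x \<in> ball y r} = {}"
    then have "hitting_time f x y r = Inf {}" unfolding hitting_time_def by (simp only: image_empty)
    then show False using assms by (simp add: Inf_enat_def)
  qed
  then obtain n where "n \<in> {n. n > 0 \<and> (f ^^ n) x \<in> ball y r}" by blast
  then have "hitting_time f x y r \<in> enat ` {n. n > 0 \<and> (f ^^ n) x \<in> ball y r}"
    unfolding hitting_time_def by (intro wellorder_InfI[of "enat n"] imageI)
  then show ?thesis using assms by auto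
qed

text \<open>Hitting times increase as the radius decreases, so bounds along \<open>r = 2\<^sup>-\<^sup>j\<close> determine the limit: between
  \<open>2\<^sup>-\<^sup>j\<^sup>-\<^sup>1\<close> and \<open>2\<^sup>-\<^sup>j\<close> the logarithm of \<open>r\<close> changes by a factor \<open>(j+1)/j\<close> only.\<close>
lemma hitting_time_ratio_tendsto:
  fixes f :: "real \<Rightarrow> real"
  assumes b: "b \<ge> 1"
    and U: "\<And>n. eventually (\<lambda>j. \<exists>m\<ge>1. \<bar>(f ^^ m) x - y\<bar> < (1/2) ^ j
          \<and> real m \<le> 2 powr (real j * (b + 1 / real (Suc n)))) sequentially"
    and Lo: "\<And>n. eventually (\<lambda>j. \<forall>m\<ge>1. \<bar>(f ^^ m) x - y\<bar> < (1/2) ^ j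
            \<longrightarrow> 2 powr (real j * (b - 1 / real (Suc n))) \<le> real m) sequentially"
  shows "((\<lambda>r. log_enat (hitting_time f x y r) / ereal (- ln r)) \<longlongrightarrow> ereal b) (at_right 0)"
proof -
  define h where "h r = ln (real (the_enat (hitting_time f x y r))) / (- ln r)" for r
  define J where "J r = nat \<lfloor>- log 2 r\<rfloor>" for r :: real
  have J: "filterlim J sequentially (at_right 0)" unfolding J_def by real_asymp
  have key: "eventually (\<lambda>r. log_enat (hitting_time f x y r) / ereal (- ln r) = ereal (h r)
      \<and> \<bar>h r - b\<bar> \<le> 2 * (1 / real (Suc n))) (at_right 0)" for n
  proof -
    define \<delta> where "\<delta> = 1 / real (Suc n)"
    have d: "0 < \<delta>" "\<delta> \<le> 1" by (auto simp: \<delta>_def)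
    \<comment> \<open>From this index on, passing from \<open>j\<close> to \<open>j + 1\<close> costs at most another \<open>\<delta>\<close> in the exponent.\<close>
    obtain j1 where j1: "real j1 \<ge> (b + \<delta>) / \<delta>" using real_arch_simple by blast
    have "eventually (\<lambda>j. \<exists>m\<ge>1. \<bar>(f ^^ m) x - y\<bar> < (1/2) ^ Suc j
          \<and> real m \<le> 2 powr (real (Suc j) * (b + \<delta>))) sequentially"
      using U[of n] eventually_sequentially_Suc[of "\<lambda>j. \<exists>m\<ge>1. \<bar>(f ^^ m) x - y\<bar> < (1/2) ^ j
          \<and> real m \<le> 2 powr (real j * (b + \<delta>))"] unfolding \<delta>_def by blast
    with Lo[of n] eventually_ge_at_top[of "max 1 j1"]
    have "eventually (\<lambda>j. (\<exists>m\<ge>1. \<bar>(f ^^ m) x - y\<bar> < (1/2) ^ Suc j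
          \<and> real m \<le> 2 powr (real (Suc j) * (b + \<delta>))) \<and>
        (\<forall>m\<ge>1. \<bar>(f ^^ m) x - y\<bar> < (1/2) ^ j
            \<longrightarrow> 2 powr (real j * (b - \<delta>)) \<le> real m) \<and> max 1 j1 \<le> j) sequentially"
      unfolding \<delta>_def by eventually_elim blast
    then have "eventually (\<lambda>r. (\<exists>m\<ge>1. \<bar>(f ^^ m) x - y\<bar> < (1/2) ^ Suc (J r)
          \<and> real m \<le> 2 powr (real (Suc (J r)) * (b + \<delta>))) \<and>
        (\<forall>m\<ge>1. \<bar>(f ^^ m) x - y\<bar> < (1/2) ^ J r
            \<longrightarrow> 2 powr (real (J r) * (b - \<delta>)) \<le> real m) \<and> max 1 j1 \<le> J r) (at_right 0)"
      using J by (rule eventually_compose_filterlim)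
    moreover have "eventually (\<lambda>r::real. 0 < r \<and> r < 1) (at_right 0)"
      unfolding eventually_at_right_field by (intro exI[of _ 1]) auto
    ultimately show ?thesis
    proof eventually_elim
      case (elim r)
      define j where "j = J r"
      have j: "1 \<le> j" "j1 \<le> j" using elim by (auto simp: j_def)
      have up: "\<exists>m\<ge>1. \<bar>(f ^^ m) x - y\<bar> < (1/2) ^ Suc j \<and> real m \<le> 2 powr (real (Suc j) * (b + \<delta>))"
        and lo: "\<And>m. m \<ge> 1 \<Longrightarrow> \<bar>(f ^^ m) x - y\<bar> < (1/2) ^ j \<Longrightarrow> 2 powr (real j * (b - \<delta>)) \<le> real m"
        using elim unfolding j_def by blast+
      have r: "0 < r" "r < 1" using elim by auto
      have "0 < - log 2 r" using r by simp
      then have jr: "real j \<le> - log 2 r" "- log 2 r < real (Suc j)"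
        by (simp_all add: j_def J_def) linarith+
      have lnr: "- ln r = - log 2 r * ln 2" by (simp add: log_def)
      have l2: "ln (2::real) > 0" by simp
      have r1: "r \<le> (1/2) ^ j"
      proof -
        have "log 2 r \<le> - real j" using jr by linarith
        then have "r \<le> 2 powr (- real j)" using r by (subst (asm) log_le_iff) auto
        then show ?thesis by (simp add: powr_minus powr_realpow power_one_over inverse_eq_divide)
      qed
      have r2: "(1/2) ^ Suc j \<le> r"
      proof -
        have "- real (Suc j) \<le> log 2 r" using jr by linarith
        then have "2 powr (- real (Suc j)) \<le> r" using r by (subst (asm) le_log_iff) auto
        then show ?thesis unfolding powr_minus powr_realpow[OF zero_less_numeral]
          by (simp add: power_one_over inverse_eq_divide)
      qed
      obtain m0 where m0: "m0 \<ge> 1" "\<bar>(f ^^ m0) x - y\<bar> < (1/2) ^ Suc j"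
        "real m0 \<le> 2 powr (real (Suc j) * (b + \<delta>))" using up by blast
      have "(f ^^ m0) x \<in> ball y r"
        using m0(2) r2 by (simp add: dist_real_def abs_minus_commute)
      then have le: "hitting_time f x y r \<le> enat m0" by (rule hitting_time_le[OF m0(1)])
      then obtain m where m: "hitting_time f x y r = enat m" "m \<le> m0"
        by (cases "hitting_time f x y r") auto
      have mm: "1 \<le> m" "(f ^^ m) x \<in> ball y r" using hitting_time_attained[OF m(1)] by auto
      have "\<bar>(f ^^ m) x - y\<bar> < (1/2) ^ j"
        using mm(2) r1 by (simp add: dist_real_def abs_minus_commute)
      then have mlo: "2 powr (real j * (b - \<delta>)) \<le> real m" using mm(1) by (intro lo)
      have mup: "real m \<le> 2 powr (real (Suc j) * (b + \<delta>))" using m(2) m0(3) by linarith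
      have hr: "h r = ln (real m) / (- ln r)" by (simp add: h_def m(1))
      have eq: "log_enat (hitting_time f x y r) / ereal (- ln r) = ereal (h r)"
        using r by (simp add: hr m(1) log_enat_def)
      have pos: "- ln r > 0" using r by simp
      have j\<delta>: "b + \<delta> \<le> real j * \<delta>"
      proof -
        have "(b + \<delta>) / \<delta> \<le> real j" using j1 j(2) by linarith
        then show ?thesis using d by (simp add: field_simps)
      qed
      have "ln (real m) \<le> ln (2 powr (real (Suc j) * (b + \<delta>)))"
        using mup mm(1) by (subst ln_le_cancel_iff) auto
      also have "\<dots> = (real j * (b + \<delta>) + (b + \<delta>)) * ln 2" by (simp add: ln_powr algebra_simps)
      also have "\<dots> \<le> (real j * (b + 2 * \<delta>)) * ln 2"
        using j\<delta> by (intro mult_right_mono) (auto simp: algebra_simps)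
      also have "\<dots> \<le> (- log 2 r * (b + 2 * \<delta>)) * ln 2"
        using jr(1) b d by (intro mult_right_mono) auto
      also have "\<dots> = (b + 2 * \<delta>) * (- ln r)" by (simp only: lnr mult_ac)
      finally have u: "h r \<le> b + 2 * \<delta>"
        unfolding hr using pos by (subst pos_divide_le_eq) auto
      have "(b - 2 * \<delta>) * (- ln r) \<le> ln (real m)"
      proof (cases "b - 2 * \<delta> \<le> 0")
        case True
        then have "(b - 2 * \<delta>) * (- ln r) \<le> 0" using pos by (intro mult_nonpos_nonneg) auto
        also have "0 \<le> ln (real m)" using mm(1) by simp
        finally show ?thesis .
      next
        case False
        have "(b - 2 * \<delta>) * (- ln r) = (b - 2 * \<delta>) * (- log 2 r) * ln 2" by (simp only: lnr mult_ac)
        also have "\<dots> \<le> (b - 2 * \<delta>) * real (Suc j) * ln 2"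
          using False jr(2) by (intro mult_right_mono mult_left_mono) auto
        also have "\<dots> \<le> (real j * (b - \<delta>)) * ln 2"
          using j\<delta> d by (intro mult_right_mono) (auto simp: algebra_simps)
        also have "\<dots> = ln (2 powr (real j * (b - \<delta>)))" by (simp add: ln_powr)
        also have "\<dots> \<le> ln (real m)" using mlo mm(1) by (subst ln_le_cancel_iff) auto
        finally show ?thesis .
      qed
      then have l: "b - 2 * \<delta> \<le> h r" unfolding hr using pos by (subst pos_le_divide_eq) auto
      show ?case using eq u l unfolding \<delta>_def by (auto simp: abs_if)
    qed
  qed
  have "(h \<longlongrightarrow> b) (at_right 0)"
  proof (rule tendstoI)
    fix e :: real assume "e > 0"
    then obtain n where n: "inverse (real (Suc n)) < e / 2" using reals_Archimedean[of "e / 2"] by auto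
    show "eventually (\<lambda>r. dist (h r) b < e) (at_right 0)"
      using key[of n] by eventually_elim (use n in \<open>auto simp: dist_real_def inverse_eq_divide\<close>)
  qed
  then have "((\<lambda>r. ereal (h r)) \<longlongrightarrow> ereal b) (at_right 0)" by simp
  moreover have "eventually (\<lambda>r. ereal (h r) = log_enat (hitting_time f x y r) / ereal (- ln r)) (at_right 0)"
    using key[of 0] by eventually_elim simp
  ultimately show ?thesis by (rule Lim_transform_eventually)
qed

lemma (in intermittent) AE_hitting_time_ratio:
  assumes y: "1/2 < y" "y \<le> 1"
  shows "AE x in D. ((\<lambda>r. log_enat (hitting_time (intermittent_map \<alpha>) x y r) / ereal (- ln r))
             \<longlongrightarrow> ereal beta) (at_right 0)"
proof -
  have "AE x in D. \<forall>n. eventually (\<lambda>j. \<exists>m\<ge>1. \<bar>(imap ^^ m) x - y\<bar> < (1/2) ^ j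
            \<and> real m \<le> 2 powr (real j * (beta + 1 / real (Suc n)))) sequentially"
    unfolding AE_all_countable using y by (intro allI AE_hit_upper) auto
  moreover have "AE x in D. \<forall>n. eventually (\<lambda>j. \<forall>m\<ge>1. \<bar>(imap ^^ m) x - y\<bar> < (1/2) ^ j
            \<longrightarrow> 2 powr (real j * (beta - 1 / real (Suc n))) \<le> real m) sequentially"
    unfolding AE_all_countable using y beta_ge
    by (intro allI AE_hit_lower) (auto intro: order_trans[of _ 1])
  ultimately show ?thesis using AE_imap_eq
  proof eventually_elim
    case (elim x)
    then show ?case by (intro hitting_time_ratio_tendsto beta_ge) auto
  qed
qed

theorem corollary2p23:
  fixes \<alpha> y :: real
  assumes "\<alpha> > 0" and "y \<in> {1/2<..1}"
  shows "AE x in lebesgue_on circle.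
           ((\<lambda>r. log_enat (hitting_time (intermittent_map \<alpha>) x y r) / ereal (- ln r))
             \<longlongrightarrow> ereal (max 1 \<alpha>)) (at_right 0)"
proof -
  interpret intermittent \<alpha> using assms(1) by unfold_locales
  define Q where "Q x \<longleftrightarrow> ((\<lambda>r. log_enat (hitting_time (intermittent_map \<alpha>) x y r) / ereal (- ln r))
             \<longlongrightarrow> ereal (max 1 \<alpha>)) (at_right 0)" for x
  have "AE x in D. Q x"
    using AE_hitting_time_ratio[of y] assms(2) unfolding Q_def beta_def by simp
  then have "AE x in lborel. x \<in> {0<..1} \<longrightarrow> Q x"
    unfolding D_def by (subst (asm) AE_restrict_space_iff) auto
  moreover have "AE x in lborel. x \<noteq> (0::real)" by (rule AE_lborel_singleton)
  ultimately have "AE x in lborel. x \<in> circle \<longrightarrow> Q x"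
    by eventually_elim auto
  then have "AE x in lebesgue. x \<in> circle \<longrightarrow> Q x" by (rule AE_completion)
  then show ?thesis
    unfolding Q_def[symmetric] by (subst AE_restrict_space_iff) auto
qed

end
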